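(* Let $\Lambda$ be a positive non-increasing continuous function on $(0,1]$. Then the function $S(z)=e^{-\frac{1+z}{1-z}}$ is cyclic in $\mathcal{B}_\Lambda^{\infty,0}$ if and only if $$\int_0^1\sqrt{\frac{\Lambda(t)}{t}}\,dt=\infty .$$
   Context: $\mathbb{D}$ is the open unit disc of $\mathbb{C}$. $\mathcal{B}_\Lambda^\infty$ is the space of all analytic functions $f$ on $\mathbb{D}$ with $$\|f\|_{\Lambda}=\sup_{z\in\mathbb{D}}|f(z)|e^{-\Lambda(1-|z|)}<+\infty,$$ and $\mathcal{B}_\Lambda^{\infty,0}=\{f\in\mathcal{B}_\Lambda^\infty:\lim_{|z|\to1^-}|f(z)|e^{-\Lambda(1-|z|)}=0\}$ with the same norm (the limit is uniform in $z$ as $|z|\to 1$). An element $f$ of a space $X$ of analytic functions on $\mathbb{D}$, invariant under multiplication by $z$, is called cyclic in $X$ if $f\in X$ and the closure in $X$ of $\{pf: p\text{ a polynomial}\}$ equals $X$. (If $\Lambda$ is bounded, $\mathcal{B}_\Lambda^{\infty,0}=\{0\}$ does not contain $S$, so $S$ is not cyclic in it.) *)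

theory Defs
  imports "HOL-Complex_Analysis.Complex_Analysis"
begin

abbreviation unit_disc :: "complex set" where
  "unit_disc \<equiv> ball 0 1"

definition weighted_abs :: "(real \<Rightarrow> real) \<Rightarrow> (complex \<Rightarrow> complex) \<Rightarrow> complex \<Rightarrow> real" where
  "weighted_abs \<Lambda> f z = cmod (f z) * exp (- \<Lambda> (1 - cmod z))"

text \<open>Functions on the disc are represented by total functions whose values outside the disc
  are arbitrary; none of the notions below depends on those values. The supremum is a real one
  and is only meaningful for functions in the space \<open>B_inf \<Lambda>\<close>.\<close>

definition norm_B :: "(real \<Rightarrow> real) \<Rightarrow> (complex \<Rightarrow> complex) \<Rightarrow> real" where
  "norm_B \<Lambda> f = (SUP z\<in>unit_disc. weighted_abs \<Lambda> f z)"

definition B_inf :: "(real \<Rightarrow> real) \<Rightarrow> (complex \<Rightarrow> complex) set" where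
  "B_inf \<Lambda> = {f. f analytic_on unit_disc \<and> bdd_above (weighted_abs \<Lambda> f ` unit_disc)}"

text \<open>The filter \<open>filtercomap cmod (at_left 1)\<close> is generated by the annuli
  \<open>r < cmod z < 1\<close>, so the limit is uniform in the argument of \<open>z\<close>.\<close>

definition B_inf_0 :: "(real \<Rightarrow> real) \<Rightarrow> (complex \<Rightarrow> complex) set" where
  "B_inf_0 \<Lambda> = {f \<in> B_inf \<Lambda>. (weighted_abs \<Lambda> f \<longlongrightarrow> 0) (filtercomap cmod (at_left 1))}"

definition closure_in ::
  "(complex \<Rightarrow> complex) set \<Rightarrow> ((complex \<Rightarrow> complex) \<Rightarrow> real) \<Rightarrow> (complex \<Rightarrow> complex) set
    \<Rightarrow> (complex \<Rightarrow> complex) set" where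
  "closure_in X nrm A = {g \<in> X. \<forall>\<epsilon>>0. \<exists>h\<in>A. nrm (\<lambda>z. h z - g z) < \<epsilon>}"

definition cyclic_in ::
  "(complex \<Rightarrow> complex) set \<Rightarrow> ((complex \<Rightarrow> complex) \<Rightarrow> real) \<Rightarrow> (complex \<Rightarrow> complex) \<Rightarrow> bool" where
  "cyclic_in X nrm f \<longleftrightarrow>
     f \<in> X \<and> closure_in X nrm (range (\<lambda>p :: complex poly. \<lambda>z. poly p z * f z)) = X"

definition S :: "complex \<Rightarrow> complex" where
  "S z = exp (- ((1 + z) / (1 - z)))"

end

theory Submission
  imports Defs
begin

text \<open>
  Put \<open>t\<^sub>n = 2\<^sup>-\<^sup>n\<close>, \<open>l\<^sub>n = \<Lambda>(t\<^sub>n)\<close>, \<open>s\<^sub>n = sqrt (t\<^sub>n / l\<^sub>n)\<close> and \<open>b\<^sub>n = sqrt (t\<^sub>n l\<^sub>n)\<close>. By monotonicity of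
  \<open>\<Lambda>\<close> the integral diverges iff the series of the \<open>b\<^sub>n\<close> does. Let \<open>H\<^sub>s(z) = (1 + s + z) / (1 + s - z)\<close>,
  so that \<open>S = exp (-H\<^sub>0)\<close>, and let \<open>P = Re H\<^sub>0\<close> be the Poisson kernel.

  Divergence. Take masses \<open>m\<^sub>n\<close> with \<open>m\<^sub>n / s\<^sub>n \<le> l\<^sub>n - l\<^bsub>n-1\<^esub>\<close> (so that these quotients telescope) and
  \<open>m\<^sub>n s\<^sub>n \<le> t\<^sub>n\<close>; the series of the \<open>m\<^sub>n\<close> still diverges. A finite sum \<open>g\<close> of small multiples of
  \<open>m\<^sub>n H\<close> at \<open>s\<^sub>n\<close> of total mass \<open>a/4\<close> satisfies \<open>Re g \<le> a P + \<Lambda>/2\<close>, and \<open>g\<close> tends to \<open>(a/4) H\<^sub>0\<close> as the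
  poles move to \<open>1\<close>. Hence multiplying \<open>S\<^sup>a\<close> by \<open>exp g\<close>, which is holomorphic across the circle,
  approximates the power \<open>3a/4\<close> of \<open>S\<close> in norm; iterating gives the constant \<open>1\<close>.

  Convergence. If \<open>p S\<close> is close to \<open>1\<close>, then \<open>ln |p| \<le> P + \<Lambda> + ln 2\<close>. With
  \<open>V = 20 \<Sum> b\<^sub>j Re H\<close> (poles at \<open>s\<^sub>j\<close>, \<open>j \<ge> J\<close>) one has \<open>P + \<Lambda> \<le> V + 3 l\<^sub>J\<close> on a staircase
  through the points with \<open>|1 - z| = s\<^sub>j\<close>, \<open>1 - |z| = t\<^sub>j\<close>. The maximum principle above the staircase gives
  \<open>P \<le> V + const\<close> on the radius towards \<open>1\<close>; multiplying by \<open>1 - |z|\<close> contradicts the small total mass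
  of \<open>V\<close>.
\<close>

section \<open>Herglotz kernels with poles outside the disc\<close>

text \<open>Herglotz kernel of the disc of radius \<open>1 + s\<close>: for \<open>0 < s\<close> it
  is holomorphic across the unit circle, and \<open>s = 0\<close> gives minus the exponent of
  \<open>S\<close>.\<close>

definition herglotz :: "real \<Rightarrow> complex \<Rightarrow> complex" where
  "herglotz s z = (1 + of_real s + z) / (1 + of_real s - z)"

lemma herglotz_dist_ge:
  assumes "0 \<le> s" "cmod z < 1"
  shows "cmod (1 - z) \<le> cmod (1 + of_real s - z)" "s + (1 - cmod z) \<le> cmod (1 + of_real s - z)"
proof -
  have "Re z < 1" using assms complex_Re_le_cmod[of z] by linarith
  then have "(1 - Re z)\<^sup>2 \<le> (1 + s - Re z)\<^sup>2" using assms by (intro power_mono) auto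
  then show "cmod (1 - z) \<le> cmod (1 + of_real s - z)" by (simp add: cmod_def)
  show "s + (1 - cmod z) \<le> cmod (1 + of_real s - z)"
    using norm_triangle_ineq2[of "1 + of_real s" z] assms
    by (metis abs_of_nonneg add_diff_eq add.commute add_nonneg_nonneg norm_of_real of_real_1 of_real_add zero_le_one)
qed

lemma Re_herglotz:
  "Re (herglotz s z) = ((1 + s)\<^sup>2 - (cmod z)\<^sup>2) / (cmod (1 + of_real s - z))\<^sup>2"
  unfolding herglotz_def cmod_power2 by (simp add: Re_divide power2_eq_square algebra_simps)

lemma Re_herglotz_nonneg:
  assumes "0 \<le> s" "cmod z < 1"
  shows "0 \<le> Re (herglotz s z)"
proof -
  have "(cmod z)\<^sup>2 \<le> (1 + s)\<^sup>2" using assms by (intro power_mono) auto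
  then show ?thesis unfolding Re_herglotz by simp
qed

text \<open>The numerator is \<open>(1 + s - |z|) (1 + s + |z|)\<close>; the first factor and
  \<open>s\<close> are at most the distance to the pole, the second factor is at most 3.\<close>

lemma Re_herglotz_le_inverse:
  assumes "0 < s" "s \<le> 1" "cmod z < 1"
  shows "Re (herglotz s z) \<le> 3 / s"
proof -
  define d where "d = cmod (1 + of_real s - z)"
  have d: "s + (1 - cmod z) \<le> d" unfolding d_def using assms by (intro herglotz_dist_ge) auto
  have "((1 + s)\<^sup>2 - (cmod z)\<^sup>2) * s = (s + (1 - cmod z)) * s * (1 + s + cmod z)"
    by (simp add: power2_eq_square algebra_simps)
  also have "\<dots> \<le> (d * d) * 3"
    using assms d by (intro mult_mono) auto
  finally show ?thesis
    unfolding Re_herglotz d_def[symmetric] using assms d by (simp add: divide_simps power2_eq_square)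
qed

text \<open>At points whose distance to the circle is at least of order \<open>s\<close>, moving the
  pole costs only a bounded factor.\<close>

lemma Re_herglotz_le_Poisson:
  assumes "0 \<le> s" "s \<le> 1" "cmod z < 1"
  shows "Re (herglotz s z) \<le> 2 * (1 + s / (1 - cmod z)) * Re (herglotz 0 z)"
proof -
  have "0 < 1 - cmod z" using assms by simp
  then have pos: "0 < cmod (1 - z)" using herglotz_dist_ge(2)[of 0 z] assms by (simp del: zero_less_norm_iff)
  have "Re (herglotz s z) \<le> ((1 + s)\<^sup>2 - (cmod z)\<^sup>2) / (cmod (1 - z))\<^sup>2"
    unfolding Re_herglotz
  proof (rule divide_left_mono)
    show "(cmod (1 - z))\<^sup>2 \<le> (cmod (1 + of_real s - z))\<^sup>2"
      using herglotz_dist_ge(1)[of s z] assms by (intro power_mono) auto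
    show "0 \<le> (1 + s)\<^sup>2 - (cmod z)\<^sup>2"
      using power_mono[of "cmod z" "1 + s" 2] assms by simp
    show "0 < (cmod (1 + of_real s - z))\<^sup>2 * (cmod (1 - z))\<^sup>2"
      using pos herglotz_dist_ge(1)[of s z] assms by (intro mult_pos_pos zero_less_power) linarith+
  qed
  also have "(1 + s)\<^sup>2 - (cmod z)\<^sup>2 \<le> 2 * (1 + s / (1 - cmod z)) * (1 - (cmod z)\<^sup>2)"
  proof -
    have "(1 + s)\<^sup>2 - (cmod z)\<^sup>2 = (1 - cmod z + s) * (1 + s + cmod z)"
      by (simp add: power2_eq_square algebra_simps)
    also have "\<dots> \<le> (1 - cmod z + s) * (2 * (1 + cmod z))"
    proof (rule mult_left_mono)
      show "1 + s + cmod z \<le> 2 * (1 + cmod z)" using assms(2) norm_ge_zero[of z] by argo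
      show "0 \<le> 1 - cmod z + s" using assms by argo
    qed
    also have "\<dots> = 2 * (1 + s / (1 - cmod z)) * (1 - (cmod z)\<^sup>2)"
      using assms by (simp add: field_simps power2_eq_square)
    finally show ?thesis .
  qed
  then have "((1 + s)\<^sup>2 - (cmod z)\<^sup>2) / (cmod (1 - z))\<^sup>2
      \<le> (2 * (1 + s / (1 - cmod z)) * (1 - (cmod z)\<^sup>2)) / (cmod (1 - z))\<^sup>2"
    by (rule divide_right_mono) simp
  finally show ?thesis by (simp add: Re_herglotz)
qed

text \<open>The numerator is at least \<open>(1 + s)^2 - 1\<close>, and the pole is within
  \<open>s + |1 - z|\<close> of \<open>z\<close>.\<close>

lemma Re_herglotz_ge:
  assumes "0 < s" "cmod z < 1"
  shows "s / (s + cmod (1 - z))\<^sup>2 \<le> Re (herglotz s z)"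
proof -
  have 1: "cmod (1 + of_real s - z) \<le> s + cmod (1 - z)"
    using norm_triangle_ineq[of "of_real s" "1 - z"] assms by (simp add: algebra_simps)
  have 2: "0 < cmod (1 + of_real s - z)" using herglotz_dist_ge(2)[of s z] assms by linarith
  have "s \<le> 1 + 2 * s + s\<^sup>2 - 1" using assms by simp
  also have "\<dots> \<le> (1 + s)\<^sup>2 - (cmod z)\<^sup>2"
    using assms by (simp add: power2_eq_square algebra_simps mult_le_one)
  finally have 3: "s \<le> (1 + s)\<^sup>2 - (cmod z)\<^sup>2" .
  show ?thesis
    unfolding Re_herglotz using 1 2 3 assms by (intro frac_le power_mono zero_less_power) auto
qed

lemma Poisson_le:
  assumes "cmod z < 1"
  shows "Re (herglotz 0 z) \<le> 2 * (1 - cmod z) / (cmod (1 - z))\<^sup>2"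
proof -
  have "1 - (cmod z)\<^sup>2 = (1 + cmod z) * (1 - cmod z)" by (simp add: power2_eq_square algebra_simps)
  also have "\<dots> \<le> 2 * (1 - cmod z)" using assms by (intro mult_right_mono) auto
  finally show ?thesis unfolding Re_herglotz by (simp add: divide_right_mono)
qed

text \<open>The difference of the two fractions has numerator \<open>-2 s z\<close>, and both poles
  are at least \<open>1 - |z|\<close> away.\<close>

lemma herglotz_diff_le:
  assumes "0 \<le> s" "cmod z < 1"
  shows "cmod (herglotz s z - herglotz 0 z) \<le> 2 * s / (1 - cmod z)\<^sup>2"
proof -
  have y: "0 < 1 - cmod z" using assms by simp
  have d: "1 - cmod z \<le> cmod (1 + of_real s - z)" "1 - cmod z \<le> cmod (1 - z)"
    using herglotz_dist_ge(2)[of s z] herglotz_dist_ge(2)[of 0 z] assms by auto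
  then have nz: "1 + of_real s - z \<noteq> 0" "1 - z \<noteq> 0" using y by auto
  have "herglotz s z - herglotz 0 z = - (2 * of_real s * z) / ((1 + of_real s - z) * (1 - z))"
    unfolding herglotz_def using nz by (simp add: divide_simps) (simp add: algebra_simps)
  then have "cmod (herglotz s z - herglotz 0 z)
      = 2 * s * cmod z / (cmod (1 + of_real s - z) * cmod (1 - z))"
    using assms by (simp add: norm_divide norm_mult)
  also have "\<dots> \<le> 2 * s * 1 / (1 - cmod z)\<^sup>2"
    unfolding power2_eq_square using assms d y
    by (intro frac_le mult_mono mult_left_mono mult_pos_pos) auto
  finally show ?thesis by simp
qed

lemma norm_herglotz_le:
  assumes "0 \<le> s" "cmod z < 1"
  shows "cmod (herglotz s z) \<le> 3 / (1 - cmod z)"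
proof -
  define y where "y = 1 - cmod z"
  have y: "0 < y" "y \<le> 1" using assms by (auto simp: y_def)
  have "cmod (1 + of_real s + z) \<le> cmod 1 + cmod (of_real s :: complex) + cmod z"
    by (meson norm_triangle_ineq norm_triangle_mono order_refl)
  then have 1: "cmod (1 + of_real s + z) \<le> 2 + s" using assms by simp
  have 2: "s + y \<le> cmod (1 + of_real s - z)"
    unfolding y_def using herglotz_dist_ge(2)[OF assms] .
  have "cmod (herglotz s z) \<le> (2 + s) / (s + y)"
    unfolding herglotz_def norm_divide using 1 2 assms(1) y by (intro frac_le) auto
  also have "\<dots> \<le> 3 / y"
  proof -
    have "s * y \<le> s * 3" using assms y by (intro mult_left_mono) auto
    then show ?thesis using assms y by (simp add: divide_simps) (simp add: algebra_simps)
  qed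
  finally show ?thesis by (simp add: y_def)
qed

lemma holomorphic_herglotz: "herglotz s holomorphic_on ball 0 (1 + s)"
proof -
  have "1 + of_real s - z \<noteq> 0" if "z \<in> ball 0 (1 + s)" for z :: complex
  proof
    assume "1 + of_real s - z = 0"
    then have "z = of_real (1 + s)" by (simp add: algebra_simps)
    then have "cmod z = \<bar>1 + s\<bar>" by (metis norm_of_real)
    then show False using that by auto
  qed
  then show ?thesis unfolding herglotz_def by (intro holomorphic_intros) auto
qed

text \<open>Convergence of the Taylor series at a point of modulus above 1 makes the coefficients
  absolutely summable, so the Taylor polynomials converge uniformly on the closed disc.\<close>

lemma polynomial_approximation:
  fixes f :: "complex \<Rightarrow> complex"
  assumes "f holomorphic_on ball 0 R" "1 < R" "0 < \<epsilon>"
  obtains p where "\<And>z. cmod z \<le> 1 \<Longrightarrow> cmod (poly p z - f z) < \<epsilon>"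
proof -
  define c where "c = (\<lambda>n. (deriv ^^ n) f 0 / fact n)"
  have sums: "(\<lambda>n. c n * z ^ n) sums f z" if "z \<in> ball 0 R" for z
    using holomorphic_power_series[OF assms(1) that] by (simp add: c_def)
  define x :: complex where "x = of_real ((1 + R) / 2)"
  have x: "x \<in> ball 0 R" "1 < cmod x" using assms by (auto simp: x_def norm_divide simp flip: of_real_add)
  have summ: "summable (\<lambda>n. cmod (c n))"
  proof -
    have "summable (\<lambda>n. c n * x ^ n)" using sums[OF x(1)] sums_summable by blast
    from powser_insidea[OF this, of 1] x(2) show ?thesis by simp
  qed
  have "uniform_limit (cball 0 1) (\<lambda>n z. \<Sum>i<n. c i * z ^ i) (\<lambda>z. suminf (\<lambda>i. c i * z ^ i)) sequentially"
  proof (rule Weierstrass_m_test)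
    show "norm (c n * z ^ n) \<le> cmod (c n)" if "z \<in> cball 0 1" for n z
      using that by (auto simp: norm_mult norm_power intro!: mult_left_le power_le_one)
  qed (fact summ)
  from uniform_limitD[OF this \<open>0 < \<epsilon>\<close>]
  obtain n where n: "\<And>z. z \<in> cball 0 1 \<Longrightarrow> dist (\<Sum>i<n. c i * z ^ i) (suminf (\<lambda>i. c i * z ^ i)) < \<epsilon>"
    unfolding eventually_sequentially by blast
  show ?thesis
  proof (rule that[of "\<Sum>i<n. monom (c i) i"])
    fix z :: complex assume z: "cmod z \<le> 1"
    then have "f z = suminf (\<lambda>i. c i * z ^ i)" using sums[of z] assms by (auto simp: sums_iff)
    then show "cmod (poly (\<Sum>i<n. monom (c i) i) z - f z) < \<epsilon>"
      using n[of z] z by (simp add: poly_sum poly_monom dist_norm)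
  qed
qed

section \<open>Approximation by polynomial multiples\<close>

text \<open>Pointwise form of lying in the closure of the polynomial multiples of \<open>f\<close>.
  It avoids the real supremum, so it makes sense without membership of \<open>f\<close> and
  \<open>h\<close> in the space.\<close>

definition approx :: "(real \<Rightarrow> real) \<Rightarrow> (complex \<Rightarrow> complex) \<Rightarrow> (complex \<Rightarrow> complex) \<Rightarrow> bool" where
  "approx \<Lambda> f h \<longleftrightarrow> (\<forall>\<epsilon>>0. \<exists>p. \<forall>z\<in>unit_disc. weighted_abs \<Lambda> (\<lambda>z. poly p z * f z - h z) z \<le> \<epsilon>)"

lemma approxI:
  assumes "\<And>\<epsilon>. 0 < \<epsilon> \<Longrightarrow> \<exists>p. \<forall>z\<in>unit_disc. weighted_abs \<Lambda> (\<lambda>z. poly p z * f z - h z) z \<le> \<epsilon>"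
  shows "approx \<Lambda> f h"
  using assms by (simp add: approx_def)

lemma approxD:
  assumes "approx \<Lambda> f h" "0 < \<epsilon>"
  obtains p where "\<And>z. z \<in> unit_disc \<Longrightarrow> weighted_abs \<Lambda> (\<lambda>z. poly p z * f z - h z) z \<le> \<epsilon>"
  using assms unfolding approx_def by blast

lemma weighted_abs_add_le:
  "weighted_abs \<Lambda> (\<lambda>z. f z + g z) z \<le> weighted_abs \<Lambda> f z + weighted_abs \<Lambda> g z"
  using norm_triangle_ineq[of "f z" "g z"] by (simp add: weighted_abs_def flip: distrib_right)

lemma weighted_abs_diff_triangle:
  "weighted_abs \<Lambda> (\<lambda>z. f z - h z) z
    \<le> weighted_abs \<Lambda> (\<lambda>z. f z - g z) z + weighted_abs \<Lambda> (\<lambda>z. g z - h z) z"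
  using weighted_abs_add_le[of \<Lambda> "\<lambda>z. f z - g z" "\<lambda>z. g z - h z" z] by simp

lemma poly_bounded_on_disc:
  fixes p :: "complex poly"
  obtains M where "0 < M" "\<And>z. cmod z \<le> 1 \<Longrightarrow> cmod (poly p z) \<le> M"
proof -
  have "compact (poly p ` cball 0 1)" by (intro compact_continuous_image continuous_intros) auto
  then have "bounded (poly p ` cball 0 1)" by (rule compact_imp_bounded)
  then show ?thesis using that unfolding bounded_pos by auto
qed

text \<open>Multiplication by a polynomial is bounded in the weighted norm, so the first error is
  chosen small relative to the bound \<open>M\<close> of \<open>q\<close>.\<close>

lemma approx_trans:
  assumes "approx \<Lambda> f g" "approx \<Lambda> g h"
  shows "approx \<Lambda> f h"
proof (rule approxI)
  fix \<epsilon> :: real assume "0 < \<epsilon>"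
  then obtain q where q: "\<And>z. z \<in> unit_disc \<Longrightarrow> weighted_abs \<Lambda> (\<lambda>z. poly q z * g z - h z) z \<le> \<epsilon> / 2"
    using approxD[OF assms(2), of "\<epsilon> / 2"] by auto
  obtain M where M: "0 < M" "\<And>z. cmod z \<le> 1 \<Longrightarrow> cmod (poly q z) \<le> M"
    using poly_bounded_on_disc by blast
  obtain p where p: "\<And>z. z \<in> unit_disc \<Longrightarrow> weighted_abs \<Lambda> (\<lambda>z. poly p z * f z - g z) z \<le> \<epsilon> / 2 / M"
    using approxD[OF assms(1), of "\<epsilon> / 2 / M"] M(1) \<open>0 < \<epsilon>\<close> by auto
  have "weighted_abs \<Lambda> (\<lambda>z. poly (q * p) z * f z - h z) z \<le> \<epsilon>" if z: "z \<in> unit_disc" for z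
  proof -
    have "weighted_abs \<Lambda> (\<lambda>z. poly (q * p) z * f z - poly q z * g z) z
        = cmod (poly q z) * weighted_abs \<Lambda> (\<lambda>z. poly p z * f z - g z) z"
      by (simp add: weighted_abs_def mult.assoc flip: norm_mult right_diff_distrib)
    also have "\<dots> \<le> M * (\<epsilon> / 2 / M)"
      using M p[OF z] z \<open>0 < \<epsilon>\<close> by (intro mult_mono) (auto simp: weighted_abs_def)
    finally show ?thesis
      using weighted_abs_diff_triangle[of \<Lambda> "\<lambda>z. poly (q * p) z * f z" h z "\<lambda>z. poly q z * g z"] q[OF z] M(1)
      by simp
  qed
  then show "\<exists>p. \<forall>z\<in>unit_disc. weighted_abs \<Lambda> (\<lambda>z. poly p z * f z - h z) z \<le> \<epsilon>" by blast
qed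

lemma approx_closed:
  assumes "\<And>\<epsilon>. 0 < \<epsilon> \<Longrightarrow> \<exists>h. approx \<Lambda> f h \<and> (\<forall>z\<in>unit_disc. weighted_abs \<Lambda> (\<lambda>z. h z - k z) z \<le> \<epsilon>)"
  shows "approx \<Lambda> f k"
proof (rule approxI)
  fix \<epsilon> :: real assume "0 < \<epsilon>"
  then obtain h where h: "approx \<Lambda> f h" "\<And>z. z \<in> unit_disc \<Longrightarrow> weighted_abs \<Lambda> (\<lambda>z. h z - k z) z \<le> \<epsilon> / 2"
    using assms[of "\<epsilon> / 2"] by auto
  obtain p where p: "\<And>z. z \<in> unit_disc \<Longrightarrow> weighted_abs \<Lambda> (\<lambda>z. poly p z * f z - h z) z \<le> \<epsilon> / 2"
    using approxD[OF h(1), of "\<epsilon> / 2"] \<open>0 < \<epsilon>\<close> by auto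
  have "weighted_abs \<Lambda> (\<lambda>z. poly p z * f z - k z) z \<le> \<epsilon>" if "z \<in> unit_disc" for z
    using weighted_abs_diff_triangle[of \<Lambda> "\<lambda>z. poly p z * f z" k z h] p[OF that] h(2)[OF that] by simp
  then show "\<exists>p. \<forall>z\<in>unit_disc. weighted_abs \<Lambda> (\<lambda>z. poly p z * f z - k z) z \<le> \<epsilon>" by blast
qed

section \<open>The weighted spaces and cyclicity in pointwise form\<close>

lemma B_inf_diff:
  assumes "f \<in> B_inf \<Lambda>" "g \<in> B_inf \<Lambda>"
  shows "(\<lambda>z. f z - g z) \<in> B_inf \<Lambda>"
proof -
  obtain A B where A: "\<And>z. z \<in> unit_disc \<Longrightarrow> weighted_abs \<Lambda> f z \<le> A"
    and B: "\<And>z. z \<in> unit_disc \<Longrightarrow> weighted_abs \<Lambda> g z \<le> B"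
    using assms unfolding B_inf_def bdd_above_def by blast
  have "weighted_abs \<Lambda> (\<lambda>z. f z - g z) z \<le> A + B" if "z \<in> unit_disc" for z
    using weighted_abs_add_le[of \<Lambda> f "\<lambda>z. - g z" z] A[OF that] B[OF that] by (simp add: weighted_abs_def)
  then show ?thesis
    using assms by (auto simp: B_inf_def bdd_above_def intro!: analytic_intros exI[of _ "A + B"])
qed

lemma norm_B_le:
  assumes "\<And>z. z \<in> unit_disc \<Longrightarrow> weighted_abs \<Lambda> f z \<le> \<epsilon>"
  shows "norm_B \<Lambda> f \<le> \<epsilon>"
  unfolding norm_B_def using assms by (intro cSUP_least) auto

lemma weighted_abs_le_norm_B:
  assumes "f \<in> B_inf \<Lambda>" "z \<in> unit_disc"
  shows "weighted_abs \<Lambda> f z \<le> norm_B \<Lambda> f"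
  unfolding norm_B_def using assms by (intro cSUP_upper) (auto simp: B_inf_def)

lemma B_inf_poly_mult:
  assumes "f \<in> B_inf \<Lambda>"
  shows "(\<lambda>z. poly p z * f z) \<in> B_inf \<Lambda>"
proof -
  obtain A where A: "\<And>z. z \<in> unit_disc \<Longrightarrow> weighted_abs \<Lambda> f z \<le> A"
    using assms unfolding B_inf_def bdd_above_def by blast
  obtain M where M: "0 < M" "\<And>z. cmod z \<le> 1 \<Longrightarrow> cmod (poly p z) \<le> M"
    using poly_bounded_on_disc by blast
  have "weighted_abs \<Lambda> (\<lambda>z. poly p z * f z) z \<le> M * A" if "z \<in> unit_disc" for z
  proof -
    have "weighted_abs \<Lambda> (\<lambda>z. poly p z * f z) z = cmod (poly p z) * weighted_abs \<Lambda> f z"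
      by (simp add: weighted_abs_def norm_mult)
    also have "\<dots> \<le> M * A" using M A[OF that] that by (intro mult_mono) (auto simp: weighted_abs_def)
    finally show ?thesis .
  qed
  then show ?thesis
    using assms unfolding B_inf_def bdd_above_def
    by (auto intro!: exI[of _ "M * A"] holomorphic_intros simp: analytic_on_open)
qed

text \<open>\<open>closure_in\<close> lies in the space by definition, so only the other inclusion
  has content. The differences stay in \<open>B_inf\<close>, which makes \<open>norm_B\<close> a
  genuine bound for their values.\<close>

lemma cyclic_in_iff_approx:
  "cyclic_in (B_inf_0 \<Lambda>) (norm_B \<Lambda>) f \<longleftrightarrow>
    f \<in> B_inf_0 \<Lambda> \<and> (\<forall>g\<in>B_inf_0 \<Lambda>. approx \<Lambda> f g)"
proof -
  have "(\<forall>\<epsilon>>0. \<exists>h\<in>range (\<lambda>p z. poly p z * f z). norm_B \<Lambda> (\<lambda>z. h z - g z) < \<epsilon>) \<longleftrightarrow> approx \<Lambda> f g"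
    if "f \<in> B_inf_0 \<Lambda>" "g \<in> B_inf_0 \<Lambda>" for g
  proof
    assume L: "\<forall>\<epsilon>>0. \<exists>h\<in>range (\<lambda>p z. poly p z * f z). norm_B \<Lambda> (\<lambda>z. h z - g z) < \<epsilon>"
    show "approx \<Lambda> f g"
    proof (rule approxI)
      fix \<epsilon> :: real assume "0 < \<epsilon>"
      then obtain p where p: "norm_B \<Lambda> (\<lambda>z. poly p z * f z - g z) < \<epsilon>" using L by blast
      have "(\<lambda>z. poly p z * f z - g z) \<in> B_inf \<Lambda>"
        using that by (intro B_inf_diff B_inf_poly_mult) (auto simp: B_inf_0_def)
      then show "\<exists>p. \<forall>z\<in>unit_disc. weighted_abs \<Lambda> (\<lambda>z. poly p z * f z - g z) z \<le> \<epsilon>"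
        using weighted_abs_le_norm_B p by (intro exI[of _ p]) fastforce
    qed
  next
    assume R: "approx \<Lambda> f g"
    show "\<forall>\<epsilon>>0. \<exists>h\<in>range (\<lambda>p z. poly p z * f z). norm_B \<Lambda> (\<lambda>z. h z - g z) < \<epsilon>"
    proof (intro allI impI)
      fix \<epsilon> :: real assume "0 < \<epsilon>"
      then obtain p where "\<And>z. z \<in> unit_disc \<Longrightarrow> weighted_abs \<Lambda> (\<lambda>z. poly p z * f z - g z) z \<le> \<epsilon> / 2"
        using approxD[OF R, of "\<epsilon> / 2"] by auto
      then have "norm_B \<Lambda> (\<lambda>z. poly p z * f z - g z) \<le> \<epsilon> / 2" by (rule norm_B_le)
      then show "\<exists>h\<in>range (\<lambda>p z. poly p z * f z). norm_B \<Lambda> (\<lambda>z. h z - g z) < \<epsilon>"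
        using \<open>0 < \<epsilon>\<close> by (intro bexI[of _ "\<lambda>z. poly p z * f z"]) auto
    qed
  qed
  then show ?thesis unfolding cyclic_in_def closure_in_def by blast
qed

lemma eventually_near_circle:
  "eventually P (filtercomap cmod (at_left 1)) \<longleftrightarrow> (\<exists>\<delta>>0. \<forall>z\<in>unit_disc. 1 - cmod z < \<delta> \<longrightarrow> P z)"
proof
  assume "eventually P (filtercomap cmod (at_left 1))"
  then obtain Q where Q: "eventually Q (at_left (1::real))" "\<And>z. Q (cmod z) \<Longrightarrow> P z"
    unfolding eventually_filtercomap by blast
  then obtain b where "b < 1" "\<And>y. b < y \<Longrightarrow> y < 1 \<Longrightarrow> Q y"
    unfolding eventually_at_left_field by blast
  then show "\<exists>\<delta>>0. \<forall>z\<in>unit_disc. 1 - cmod z < \<delta> \<longrightarrow> P z"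
    using Q(2) by (intro exI[of _ "1 - b"]) auto
next
  assume "\<exists>\<delta>>0. \<forall>z\<in>unit_disc. 1 - cmod z < \<delta> \<longrightarrow> P z"
  then obtain \<delta> where "0 < \<delta>" "\<And>z. cmod z < 1 \<Longrightarrow> 1 - \<delta> < cmod z \<Longrightarrow> P z" by force
  then show "eventually P (filtercomap cmod (at_left 1))"
    unfolding eventually_filtercomap eventually_at_left_field
    by (intro exI[of _ "\<lambda>y. 1 - \<delta> < y \<and> y < 1"]) (auto intro!: exI[of _ "1 - \<delta>"])
qed

lemma weighted_abs_tendsto_0_iff:
  "(weighted_abs \<Lambda> f \<longlongrightarrow> 0) (filtercomap cmod (at_left 1)) \<longleftrightarrow>
    (\<forall>\<epsilon>>0. \<exists>\<delta>>0. \<forall>z\<in>unit_disc. 1 - cmod z < \<delta> \<longrightarrow> weighted_abs \<Lambda> f z < \<epsilon>)"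
  unfolding tendsto_iff eventually_near_circle by (simp add: weighted_abs_def dist_real_def abs_mult)

section \<open>Non-increasing weights and density of polynomials\<close>

locale weight =
  fixes \<Lambda> :: "real \<Rightarrow> real"
  assumes pos: "\<And>t. t \<in> {0<..1} \<Longrightarrow> 0 < \<Lambda> t"
    and antimono: "antimono_on {0<..1} \<Lambda>"
begin

lemma Lambda_mono: "0 < t \<Longrightarrow> t \<le> u \<Longrightarrow> u \<le> 1 \<Longrightarrow> \<Lambda> u \<le> \<Lambda> t"
  using antimono by (auto simp: monotone_on_def)

lemma weighted_abs_le:
  assumes "z \<in> unit_disc"
  shows "weighted_abs \<Lambda> f z \<le> cmod (f z)"
  using pos[of "1 - cmod z"] assms by (auto simp: weighted_abs_def intro!: mult_left_le)

text \<open>The dilates \<open>g (r z)\<close> are holomorphic on a larger disc, hence limits of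
  polynomials. They are close to \<open>g\<close> on a compact disc by uniform continuity; near the
  circle both are small in the weight.\<close>

lemma polynomials_dense:
  assumes "g \<in> B_inf_0 \<Lambda>"
  shows "approx \<Lambda> (\<lambda>_. 1) g"
proof (rule approx_closed)
  fix \<epsilon> :: real assume "0 < \<epsilon>"
  have hol: "g holomorphic_on unit_disc"
    using assms by (auto simp: B_inf_0_def B_inf_def analytic_on_open)
  obtain \<delta> where \<delta>: "0 < \<delta>" "\<And>z. z \<in> unit_disc \<Longrightarrow> 1 - cmod z < \<delta> \<Longrightarrow> weighted_abs \<Lambda> g z < \<epsilon> / 2"
  proof -
    have "\<exists>\<delta>>0. \<forall>z\<in>unit_disc. 1 - cmod z < \<delta> \<longrightarrow> weighted_abs \<Lambda> g z < \<epsilon> / 2"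
      using assms half_gt_zero[OF \<open>0 < \<epsilon>\<close>] unfolding B_inf_0_def weighted_abs_tendsto_0_iff by blast
    then show ?thesis using that by blast
  qed
  have "uniformly_continuous_on (cball 0 (1 - \<delta> / 2)) g"
  proof (intro compact_uniformly_continuous holomorphic_on_imp_continuous_on holomorphic_on_subset[OF hol] subsetI)
    fix z :: complex assume "z \<in> cball 0 (1 - \<delta> / 2)"
    then show "z \<in> unit_disc" using \<delta>(1) by simp
  qed simp
  then obtain \<eta> where \<eta>: "0 < \<eta>"
    "\<And>z w. z \<in> cball 0 (1 - \<delta> / 2) \<Longrightarrow> w \<in> cball 0 (1 - \<delta> / 2) \<Longrightarrow> dist w z < \<eta> \<Longrightarrow> dist (g w) (g z) < \<epsilon>"
    using \<open>0 < \<epsilon>\<close> unfolding uniformly_continuous_on_def by blast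
  \<comment> \<open>The bound 1/2 keeps \<open>r\<close> positive, \<open>\<eta>\<close> serves
    uniform continuity, and \<open>\<delta> / 2\<close> keeps the dilates of points near the circle
    in the annulus where \<open>g\<close> is small.\<close>
  define r where "r = 1 - min (1 / 2) (min (\<eta> / 2) (\<delta> / 2))"
  have r: "1 / 2 \<le> r" "r < 1" "1 - r < \<eta>" "1 - r \<le> \<delta> / 2"
    using \<eta>(1) \<delta>(1) by (auto simp: r_def min_def)
  have rz: "cmod (of_real r * z) \<le> cmod z" for z
    using r by (simp add: norm_mult mult_left_le_one_le)
  show "\<exists>h. approx \<Lambda> (\<lambda>_. 1) h \<and> (\<forall>z\<in>unit_disc. weighted_abs \<Lambda> (\<lambda>z. h z - g z) z \<le> \<epsilon>)"
  proof (intro exI[of _ "\<lambda>z. g (of_real r * z)"] conjI ballI)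
    show "approx \<Lambda> (\<lambda>_. 1) (\<lambda>z. g (of_real r * z))"
    proof (rule approxI)
      fix \<epsilon>' :: real assume "0 < \<epsilon>'"
      have "(g \<circ> (\<lambda>z. of_real r * z)) holomorphic_on ball 0 (1 / r)"
      proof (rule holomorphic_on_compose_gen[OF _ hol])
        show "(\<lambda>z. of_real r * z) ` ball 0 (1 / r) \<subseteq> unit_disc"
          using r by (auto simp: norm_mult field_simps)
      qed (intro holomorphic_intros)
      from polynomial_approximation[OF this _ \<open>0 < \<epsilon>'\<close>]
      obtain p where p: "\<And>z. cmod z \<le> 1 \<Longrightarrow> cmod (poly p z - g (of_real r * z)) < \<epsilon>'"
        using r by auto
      have "weighted_abs \<Lambda> (\<lambda>z. poly p z * 1 - g (of_real r * z)) z \<le> \<epsilon>'" if "z \<in> unit_disc" for z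
        using weighted_abs_le[OF that, of "\<lambda>z. poly p z * 1 - g (of_real r * z)"] p[of z] that by auto
      then show "\<exists>p. \<forall>z\<in>unit_disc. weighted_abs \<Lambda> (\<lambda>z. poly p z * 1 - g (of_real r * z)) z \<le> \<epsilon>'" by blast
    qed
  next
    fix z assume z: "z \<in> unit_disc"
    have rz1: "of_real r * z \<in> unit_disc" using rz[of z] z by auto
    show "weighted_abs \<Lambda> (\<lambda>z. g (of_real r * z) - g z) z \<le> \<epsilon>"
    proof (cases "1 - cmod z < \<delta> / 2")
      case True
      have "cmod z - cmod (of_real r * z) = (1 - r) * cmod z" using r by (simp add: norm_mult algebra_simps)
      also have "\<dots> \<le> (1 - r) * 1" using r z by (intro mult_left_mono) auto
      finally have "1 - cmod (of_real r * z) < \<delta>" using True r by simp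
      with \<delta>(2) rz1 have *: "weighted_abs \<Lambda> g (of_real r * z) < \<epsilon> / 2" by blast
      \<comment> \<open>Dilation moves \<open>z\<close> inwards, where \<open>\<Lambda>\<close> is
        no larger.\<close>
      have "weighted_abs \<Lambda> (\<lambda>z. g (of_real r * z)) z \<le> weighted_abs \<Lambda> g (of_real r * z)"
        unfolding weighted_abs_def using rz[of z] z
        by (intro mult_left_mono) (auto intro!: Lambda_mono)
      then show ?thesis
        using weighted_abs_add_le[of \<Lambda> "\<lambda>z. g (of_real r * z)" "\<lambda>z. - g z" z] * \<delta>(2)[OF z] True \<delta>(1)
        by (simp add: weighted_abs_def)
    next
      case False
      have "dist (of_real r * z) z = cmod (of_real (1 - r) * z)"
        by (simp add: dist_norm norm_minus_commute algebra_simps)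
      also have "\<dots> \<le> 1 - r" using r z by (simp only: norm_mult norm_of_real) (auto intro!: mult_left_le)
      finally have "dist (g (of_real r * z)) (g z) < \<epsilon>"
        using False r rz[of z] by (intro \<eta>(2)) auto
      then show ?thesis
        using weighted_abs_le[OF z, of "\<lambda>z. g (of_real r * z) - g z"] by (simp add: dist_norm)
    qed
  qed
qed

end

section \<open>Divergent masses imply cyclicity\<close>

definition dyadic :: "nat \<Rightarrow> real" where
  "dyadic n = (1 / 2) ^ n"

lemma dyadic_pos [simp]: "0 < dyadic n"
  and dyadic_le_one [simp]: "dyadic n \<le> 1"
  and dyadic_Suc: "dyadic (Suc n) = dyadic n / 2"
  by (simp_all add: dyadic_def power_le_one)

lemma dyadic_nonneg [simp]: "0 \<le> dyadic n" and dyadic_neq_0 [simp]: "dyadic n \<noteq> 0"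
  using dyadic_pos[of n] by linarith+

lemma dyadic_antimono: "m \<le> n \<Longrightarrow> dyadic n \<le> dyadic m"
  by (simp add: dyadic_def power_decreasing)

lemma sum_dyadic_Suc: "k \<le> n \<Longrightarrow> (\<Sum>i=k..<n. dyadic (Suc i)) = dyadic k - dyadic n"
  by (induction n rule: dec_induct) (simp_all add: dyadic_Suc)

lemma dyadic_tendsto_0: "dyadic \<longlonglongrightarrow> 0"
  unfolding dyadic_def by (rule LIMSEQ_power_zero) simp

definition Sa :: "real \<Rightarrow> complex \<Rightarrow> complex" where
  "Sa a z = exp (- (of_real a * herglotz 0 z))"

lemma S_eq_Sa: "S = Sa 1"
  by (simp add: fun_eq_iff S_def Sa_def herglotz_def)

lemma norm_Sa: "cmod (Sa a z) = exp (- (a * Re (herglotz 0 z)))"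
  by (simp add: Sa_def)

lemma norm_Sa_le_one: "0 \<le> a \<Longrightarrow> cmod z < 1 \<Longrightarrow> cmod (Sa a z) \<le> 1"
  using Re_herglotz_nonneg[of 0 z] by (simp add: norm_Sa)

section \<open>Dyadic quantities of the weight and the masses\<close>

context weight
begin

definition lam :: "nat \<Rightarrow> real" where
  "lam n = \<Lambda> (dyadic n)"

text \<open>Up to constants and an index shift, the integral of
  \<open>sqrt (\<Lambda> t / t)\<close> over the dyadic interval at this scale.\<close>

definition b :: "nat \<Rightarrow> real" where
  "b n = sqrt (dyadic n * lam n)"

text \<open>The mass at scale \<open>dyadic n\<close> sits at distance \<open>s n\<close> from \<open>1\<close>: this is where the
  Poisson kernel at height \<open>dyadic n\<close>, of size \<open>dyadic n / (s n)\<^sup>2\<close>, equals \<open>\<Lambda> (dyadic n)\<close>.\<close>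

definition s :: "nat \<Rightarrow> real" where
  "s n = sqrt (dyadic n / lam n)"

lemma lam_pos [simp]: "0 < lam n"
  unfolding lam_def by (intro pos) auto

lemma lam_nonneg [simp]: "0 \<le> lam n" and lam_neq_0 [simp]: "lam n \<noteq> 0"
  using lam_pos[of n] by linarith+

lemma lam_mono: "m \<le> n \<Longrightarrow> lam m \<le> lam n"
  unfolding lam_def by (intro Lambda_mono dyadic_antimono) auto

lemma b_pos [simp]: "0 < b n" and s_pos [simp]: "0 < s n"
  by (simp_all add: b_def s_def)

lemma b_nonneg [simp]: "0 \<le> b n" and s_nonneg [simp]: "0 \<le> s n" and s_neq_0 [simp]: "s n \<noteq> 0"
  using b_pos[of n] s_pos[of n] by linarith+

lemma s_power2: "(s n)\<^sup>2 = dyadic n / lam n"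
  by (simp add: s_def)

lemma b_times_s: "b n * s n = dyadic n"
  by (simp add: b_def s_def flip: real_sqrt_mult)

lemma s_strict_antimono:
  assumes "m < n" shows "s n < s m"
proof -
  have "dyadic n < dyadic m" using assms by (simp add: dyadic_def power_strict_decreasing)
  then have "dyadic n / lam n < dyadic m / lam m"
    using lam_mono[of m n] assms by (intro frac_less) auto
  then show ?thesis by (simp add: s_def)
qed

lemma s_antimono: "m \<le> n \<Longrightarrow> s n \<le> s m"
  using s_strict_antimono[of m n] by (cases "m = n") auto

lemma s_tendsto_0: "s \<longlonglongrightarrow> 0"
proof (rule tendsto_sandwich[of "\<lambda>_. 0" s _ "\<lambda>n. sqrt (dyadic n / lam 0)"])
  show "\<forall>\<^sub>F n in sequentially. s n \<le> sqrt (dyadic n / lam 0)"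
    by (intro always_eventually allI) (auto simp: s_def intro!: divide_left_mono lam_mono)
  have "(\<lambda>n. sqrt (dyadic n / lam 0)) \<longlonglongrightarrow> sqrt (0 / lam 0)"
    by (intro tendsto_real_sqrt tendsto_divide dyadic_tendsto_0 tendsto_const) simp
  then show "(\<lambda>n. sqrt (dyadic n / lam 0)) \<longlonglongrightarrow> 0" by simp
qed auto

text \<open>Carried by the pole at \<open>s (Suc n)\<close>. A difference of roots replaces
  \<open>b (Suc n)\<close> so that the quotient by \<open>s (Suc n)\<close> telescopes against
  \<open>lam\<close>.\<close>

definition mass :: "nat \<Rightarrow> real" where
  "mass n = sqrt (dyadic (Suc n)) * (sqrt (lam (Suc n)) - sqrt (lam n))"

lemma mass_nonneg [simp]: "0 \<le> mass n"
  by (simp add: mass_def lam_mono)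

lemma mass_eq: "mass n = b (Suc n) - b n / sqrt 2"
  by (simp add: mass_def b_def dyadic_Suc real_sqrt_mult real_sqrt_divide algebra_simps)

lemma mass_div_s_le: "mass n / s (Suc n) \<le> lam (Suc n) - lam n"
proof -
  have "mass n / s (Suc n) = sqrt (lam (Suc n)) * (sqrt (lam (Suc n)) - sqrt (lam n))"
    by (simp add: mass_def s_def real_sqrt_divide)
  also have "\<dots> = lam (Suc n) - sqrt (lam (Suc n)) * sqrt (lam n)"
    by (simp add: algebra_simps)
  finally have "mass n / s (Suc n) = lam (Suc n) - sqrt (lam (Suc n)) * sqrt (lam n)" .
  moreover have "sqrt (lam n) * sqrt (lam n) \<le> sqrt (lam (Suc n)) * sqrt (lam n)"
    by (intro mult_right_mono) (auto simp: lam_mono)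
  ultimately show ?thesis by simp
qed

lemma mass_times_s_le: "mass n * s (Suc n) \<le> dyadic (Suc n)"
proof -
  have "mass n \<le> b (Suc n)" by (simp add: mass_eq)
  then have "mass n * s (Suc n) \<le> b (Suc n) * s (Suc n)" by (intro mult_right_mono) auto
  then show ?thesis by (simp add: b_times_s)
qed

text \<open>By \<open>mass_eq\<close>, \<open>b (Suc n)\<close> is \<open>mass n\<close> plus a
  fixed fraction of \<open>b n\<close>, so a bound for the sums of \<open>mass\<close> bounds those
  of \<open>b\<close>.\<close>

lemma not_summable_mass:
  assumes "\<not> summable b"
  shows "\<not> summable mass"
proof
  assume mass: "summable mass"
  define M where "M = suminf mass"
  \<comment> \<open>With \<open>3 / 4\<close> above \<open>1 / sqrt 2\<close>, a partial sum
    \<open>B\<close> satisfies \<open>B \<le> b 0 + M + 3/4 B\<close>; hence the factor 4.\<close>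
  have "(\<Sum>n<N. b n) \<le> 4 * (M + b 0)" for N
  proof -
    have "b n / sqrt 2 \<le> 3 / 4 * b n" for n
    proof -
      have "4 / 3 \<le> sqrt (2::real)" by (rule real_le_rsqrt) (simp add: power2_eq_square)
      then have "b n / sqrt 2 \<le> b n / (4 / 3)" by (intro divide_left_mono) auto
      then show ?thesis by simp
    qed
    then have "b (Suc n) \<le> mass n + 3 / 4 * b n" for n unfolding mass_eq by (simp add: algebra_simps)
    then have "(\<Sum>n<N. b (Suc n)) \<le> (\<Sum>n<N. mass n) + 3 / 4 * (\<Sum>n<N. b n)"
      unfolding sum_distrib_left sum.distrib[symmetric] by (intro sum_mono)
    moreover have "(\<Sum>n<N. mass n) \<le> M"
      unfolding M_def using mass by (intro sum_le_suminf) auto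
    moreover have "(\<Sum>n<N. b n) \<le> (\<Sum>n<Suc N. b n)" by simp
    moreover have "(\<Sum>n<Suc N. b n) = b 0 + (\<Sum>n<N. b (Suc n))" by (rule sum.lessThan_Suc_shift)
    ultimately show ?thesis by argo
  qed
  then have "summable b" by (intro summableI_nonneg_bounded) auto
  with assms show False by blast
qed

text \<open>If \<open>lam\<close> were bounded, \<open>b\<close> would be dominated by a geometric
  series.\<close>

lemma Lambda_at_top:
  assumes "\<not> summable b"
  shows "filterlim \<Lambda> at_top (at_right 0)"
proof -
  have "\<exists>n. C \<le> lam n" for C
  proof (rule ccontr)
    assume "\<nexists>n. C \<le> lam n"
    then have C: "lam n \<le> C" for n by (meson linear)
    have C0: "0 \<le> C" using C[of 0] lam_pos[of 0] by linarith
    have "summable (\<lambda>n. sqrt C * sqrt (1 / 2) ^ n)"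
      by (intro summable_mult summable_geometric) simp
    then have "summable b"
    proof (rule summable_comparison_test')
      show "norm (b n) \<le> sqrt C * sqrt (1 / 2) ^ n" for n
        using C[of n] C0 by (simp add: b_def dyadic_def real_sqrt_mult real_sqrt_power mult.commute mult_left_mono)
    qed
    with assms show False by blast
  qed
  then show ?thesis
    unfolding filterlim_at_top eventually_at_right_field
  proof (intro allI)
    fix Z :: real
    obtain n where "Z \<le> lam n" using \<open>\<And>C. \<exists>n. C \<le> lam n\<close> by blast
    then show "\<exists>b>0. \<forall>y>0. y < b \<longrightarrow> Z \<le> \<Lambda> y"
      using Lambda_mono[of _ "dyadic n"] by (intro exI[of _ "dyadic n"]) (force simp: lam_def)
  qed
qed

text \<open>The bound is independent of the number of poles, so the mass may be spread over many
  small scales; the term in \<open>\<Lambda>\<close> is absorbed by the weight.\<close>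

lemma Re_sum_herglotz_le:
  fixes I :: "nat set"
  assumes "finite I" "\<And>n. n \<in> I \<Longrightarrow> s (Suc n) \<le> 1" and z: "z \<in> unit_disc"
    and \<theta>: "0 \<le> \<theta>" "\<theta> \<le> a / 8" "\<theta> \<le> 1 / 6" "\<theta> * sum mass I \<le> a / 4"
  shows "Re (\<Sum>n\<in>I. of_real (\<theta> * mass n) * herglotz (s (Suc n)) z)
    \<le> a * Re (herglotz 0 z) + \<Lambda> (1 - cmod z) / 2"
proof -
  define y where "y = 1 - cmod z"
  define P where "P = Re (herglotz 0 z)"
  \<comment> \<open>Poles with \<open>y < dyadic (Suc n)\<close> are charged to \<open>\<Lambda> y\<close> by telescoping, the others to \<open>P\<close>.\<close>
  define A where "A = {n\<in>I. y < dyadic (Suc n)}"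
  define B where "B = {n\<in>I. dyadic (Suc n) \<le> y}"
  have y: "0 < y" "y \<le> 1" using z by (auto simp: y_def)
  have P: "0 \<le> P" unfolding P_def using z by (intro Re_herglotz_nonneg) auto
  have I: "I = A \<union> B" "A \<inter> B = {}" "finite A" "finite B" using assms(1) by (auto simp: A_def B_def)
  have sumA: "(\<Sum>n\<in>A. lam (Suc n) - lam n) \<le> \<Lambda> y"
  proof (cases "A = {}")
    case True
    then show ?thesis using pos[of y] y by simp
  next
    case False
    define k where "k = Max A"
    have k: "k \<in> A" "A \<subseteq> {..<Suc k}" using I False by (auto simp: k_def less_Suc_eq_le)
    have "(\<Sum>n\<in>A. lam (Suc n) - lam n) \<le> (\<Sum>n<Suc k. lam (Suc n) - lam n)"
      using k(2) by (intro sum_mono2) (auto simp: lam_mono)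
    also have "\<dots> = lam (Suc k) - lam 0" by (rule sum_lessThan_telescope)
    also have "\<dots> \<le> lam (Suc k)" by simp
    also have "\<dots> \<le> \<Lambda> y" unfolding lam_def using k(1) y by (intro Lambda_mono) (auto simp: A_def)
    finally show ?thesis .
  qed
  \<comment> \<open>Geometric series: from the smallest index \<open>k\<close> on, the scales sum to
    at most \<open>dyadic k\<close>, which is twice \<open>dyadic (Suc k)\<close>.\<close>
  have sumB: "(\<Sum>n\<in>B. dyadic (Suc n)) \<le> 2 * y"
  proof (cases "B = {}")
    case True
    then show ?thesis using y by simp
  next
    case False
    define k where "k = Min B"
    have k: "k \<in> B" "B \<subseteq> {k..<Suc (Max B)}" using I False by (auto simp: k_def less_Suc_eq_le)
    then have le: "k \<le> Suc (Max B)" by auto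
    have "(\<Sum>n\<in>B. dyadic (Suc n)) \<le> (\<Sum>n=k..<Suc (Max B). dyadic (Suc n))"
      using k(2) by (intro sum_mono2) auto
    also have "\<dots> \<le> dyadic k" unfolding sum_dyadic_Suc[OF le] by simp
    also have "\<dots> \<le> 2 * y" using k(1) by (simp add: B_def dyadic_Suc)
    finally show ?thesis .
  qed
  have "(\<Sum>n\<in>A. \<theta> * mass n * Re (herglotz (s (Suc n)) z)) \<le> (\<Sum>n\<in>A. 3 * \<theta> * (lam (Suc n) - lam n))"
  proof (rule sum_mono)
    fix n assume "n \<in> A"
    then have "Re (herglotz (s (Suc n)) z) \<le> 3 / s (Suc n)"
      using assms(2)[of n] z by (intro Re_herglotz_le_inverse) (auto simp: A_def)
    then have "\<theta> * mass n * Re (herglotz (s (Suc n)) z) \<le> \<theta> * mass n * (3 / s (Suc n))"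
      using \<theta>(1) by (intro mult_left_mono) auto
    also have "\<dots> = 3 * \<theta> * (mass n / s (Suc n))" by simp
    also have "\<dots> \<le> 3 * \<theta> * (lam (Suc n) - lam n)"
      using \<theta>(1) by (intro mult_left_mono mass_div_s_le) auto
    finally show "\<theta> * mass n * Re (herglotz (s (Suc n)) z) \<le> 3 * \<theta> * (lam (Suc n) - lam n)" .
  qed
  also have "\<dots> = 3 * \<theta> * (\<Sum>n\<in>A. lam (Suc n) - lam n)" by (simp add: sum_distrib_left)
  also have "\<dots> \<le> 3 * (1 / 6) * \<Lambda> y"
    using sumA \<theta> by (intro mult_mono) (auto intro!: sum_nonneg simp: lam_mono)
  finally have 1: "(\<Sum>n\<in>A. \<theta> * mass n * Re (herglotz (s (Suc n)) z)) \<le> \<Lambda> y / 2" by simp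
  have "(\<Sum>n\<in>B. \<theta> * mass n * Re (herglotz (s (Suc n)) z))
      \<le> (\<Sum>n\<in>B. 2 * P * \<theta> * (mass n + dyadic (Suc n) / y))"
  proof (rule sum_mono)
    fix n assume "n \<in> B"
    then have "Re (herglotz (s (Suc n)) z) \<le> 2 * (1 + s (Suc n) / y) * P"
      unfolding y_def P_def using assms(2)[of n] z by (intro Re_herglotz_le_Poisson) (auto simp: B_def)
    then have "\<theta> * mass n * Re (herglotz (s (Suc n)) z) \<le> \<theta> * mass n * (2 * (1 + s (Suc n) / y) * P)"
      using \<theta>(1) by (intro mult_left_mono) auto
    also have "\<dots> = 2 * P * \<theta> * (mass n + mass n * s (Suc n) / y)" by (simp add: algebra_simps)
    also have "\<dots> \<le> 2 * P * \<theta> * (mass n + dyadic (Suc n) / y)"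
      using \<theta>(1) P y by (intro mult_left_mono add_left_mono divide_right_mono mass_times_s_le) auto
    finally show "\<theta> * mass n * Re (herglotz (s (Suc n)) z) \<le> 2 * P * \<theta> * (mass n + dyadic (Suc n) / y)" .
  qed
  also have "\<dots> = 2 * P * (\<theta> * sum mass B + \<theta> * ((\<Sum>n\<in>B. dyadic (Suc n)) / y))"
    by (simp add: sum_distrib_left sum.distrib sum_divide_distrib algebra_simps)
  \<comment> \<open>\<open>a / 4\<close> bounds the scaled mass, \<open>a / 8 * 2\<close> is the cap
    on \<open>\<theta>\<close> times the geometric sum; the prefactor 2 brings the total to
    \<open>a * P\<close>.\<close>
  also have "\<dots> \<le> 2 * P * (a / 4 + a / 8 * 2)"
  proof (intro mult_left_mono add_mono mult_mono)
    have "\<theta> * sum mass B \<le> \<theta> * sum mass I"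
      using assms(1) \<theta>(1) by (intro mult_left_mono sum_mono2) (auto simp: B_def)
    then show "\<theta> * sum mass B \<le> a / 4" using \<theta>(4) by linarith
    show "(\<Sum>n\<in>B. dyadic (Suc n)) / y \<le> 2" using sumB y by (simp add: divide_simps)
  qed (use \<theta> P y in \<open>auto intro!: divide_nonneg_nonneg sum_nonneg\<close>)
  finally have 2: "(\<Sum>n\<in>B. \<theta> * mass n * Re (herglotz (s (Suc n)) z)) \<le> a * P" by (simp add: mult.commute)
  have "Re (\<Sum>n\<in>I. of_real (\<theta> * mass n) * herglotz (s (Suc n)) z)
      = (\<Sum>n\<in>I. \<theta> * mass n * Re (herglotz (s (Suc n)) z))"
    by (simp flip: of_real_mult)
  also have "\<dots> = (\<Sum>n\<in>A. \<theta> * mass n * Re (herglotz (s (Suc n)) z))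
      + (\<Sum>n\<in>B. \<theta> * mass n * Re (herglotz (s (Suc n)) z))"
    unfolding I(1) using I(2-4) by (intro sum.union_disjoint)
  finally show ?thesis using 1 2 by (simp add: y_def P_def)
qed

section \<open>From \<open>S\<close> through its powers to the constant 1\<close>

lemma exp_Lambda_small:
  assumes "\<not> summable b" "0 < \<epsilon>"
  obtains \<delta> where "0 < \<delta>" "\<And>y. 0 < y \<Longrightarrow> y < \<delta> \<Longrightarrow> exp (- (\<Lambda> y / 2)) \<le> \<epsilon>"
proof -
  have "eventually (\<lambda>y. 2 * ln (1 / \<epsilon>) \<le> \<Lambda> y) (at_right 0)"
    using Lambda_at_top[OF assms(1)] unfolding filterlim_at_top by blast
  then obtain \<delta> where \<delta>: "0 < \<delta>" "\<And>y. 0 < y \<Longrightarrow> y < \<delta> \<Longrightarrow> 2 * ln (1 / \<epsilon>) \<le> \<Lambda> y"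
    unfolding eventually_at_right_field by auto
  have "exp (- (\<Lambda> y / 2)) \<le> \<epsilon>" if "0 < y" "y < \<delta>" for y
  proof -
    have "- (\<Lambda> y / 2) \<le> ln \<epsilon>" using \<delta>(2)[OF that] assms(2) by (simp add: ln_div)
    then show ?thesis using assms(2) by (simp add: ln_ge_iff)
  qed
  with \<delta>(1) show ?thesis using that by blast
qed

lemma exp_near_zero:
  assumes "0 < \<epsilon>"
  obtains \<eta> where "0 < \<eta>" "\<And>w :: complex. cmod w < \<eta> \<Longrightarrow> cmod (exp w - 1) < \<epsilon>"
proof -
  have "isCont (exp :: complex \<Rightarrow> complex) 0" by simp
  then show ?thesis
    using assms that unfolding continuous_at_eps_delta by (metis diff_zero dist_norm exp_zero)
qed

text \<open>Under the bound \<open>a * P\<close> the kernel estimate admits total mass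
  \<open>a / 4\<close>, so one multiplication by \<open>exp g\<close> removes a quarter of the
  exponent.\<close>

lemma approx_Sa_step:
  assumes "\<not> summable b" "0 < a"
  shows "approx \<Lambda> (Sa a) (Sa (3 / 4 * a))"
proof (rule approxI)
  fix \<epsilon> :: real assume "0 < \<epsilon>"
  obtain \<delta> where \<delta>: "0 < \<delta>" "\<And>y. 0 < y \<Longrightarrow> y < \<delta> \<Longrightarrow> exp (- (\<Lambda> y / 2)) \<le> \<epsilon> / 4"
    using exp_Lambda_small[OF assms(1), of "\<epsilon> / 4"] \<open>0 < \<epsilon>\<close> by auto
  obtain \<eta> where \<eta>: "0 < \<eta>" "\<And>w :: complex. cmod w < \<eta> \<Longrightarrow> cmod (exp w - 1) < \<epsilon> / 2"
    using exp_near_zero[of "\<epsilon> / 2"] \<open>0 < \<epsilon>\<close> by auto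
  \<comment> \<open>The threshold is what makes \<open>g\<close> differ from \<open>a / 4\<close>
    times the kernel at \<open>s = 0\<close> by less than \<open>\<eta>\<close> where
    \<open>1 - |z| \<ge> \<delta>\<close>.\<close>
  have "eventually (\<lambda>n. s n < min 1 (\<eta> * 2 * \<delta>\<^sup>2 / a)) sequentially"
    using s_tendsto_0 by (rule order_tendstoD) (use \<eta> \<delta> assms in auto)
  then obtain n0 where n0: "\<And>n. n0 \<le> n \<Longrightarrow> s n < 1" "\<And>n. n0 \<le> n \<Longrightarrow> s n < \<eta> * 2 * \<delta>\<^sup>2 / a"
    unfolding eventually_sequentially by auto
  \<comment> \<open>By divergence some block beyond \<open>n0\<close> has mass at least
    \<open>a / 4 / \<theta>0\<close>; scaling its total to exactly \<open>a / 4\<close> keeps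
    \<open>\<theta>\<close> below both caps.\<close>
  define \<theta>0 where "\<theta>0 = min (a / 8) (1 / 6)"
  have \<theta>0: "0 < \<theta>0" using assms by (simp add: \<theta>0_def)
  have "\<exists>N. a / 4 / \<theta>0 \<le> (\<Sum>n=n0..<N. mass n)"
  proof (rule ccontr)
    assume "\<nexists>N. a / 4 / \<theta>0 \<le> (\<Sum>n=n0..<N. mass n)"
    then have bd: "(\<Sum>n=n0..<N. mass n) \<le> a / 4 / \<theta>0" for N by (meson linear)
    have "(\<Sum>i<N. mass (i + n0)) \<le> a / 4 / \<theta>0" for N
      using bd[of "N + n0"] sum.shift_bounds_nat_ivl[of mass 0 n0 N] by (simp add: atLeast0LessThan)
    then have "summable (\<lambda>i. mass (i + n0))" by (intro summableI_nonneg_bounded) auto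
    then show False using not_summable_mass[OF assms(1)] summable_iff_shift by blast
  qed
  then obtain N where N: "a / 4 / \<theta>0 \<le> (\<Sum>n=n0..<N. mass n)" by blast
  define M where "M = (\<Sum>n=n0..<N. mass n)"
  have "0 < a / 4 / \<theta>0" using \<theta>0 assms by simp
  then have M: "0 < M" using N by (simp add: M_def)
  define \<theta> where "\<theta> = a / 4 / M"
  have \<theta>: "0 \<le> \<theta>" "\<theta> \<le> \<theta>0" "\<theta> * M = a / 4"
    using M assms N \<theta>0 unfolding \<theta>_def M_def[symmetric] by (auto simp: field_simps)
  define g where "g z = (\<Sum>n=n0..<N. of_real (\<theta> * mass n) * herglotz (s (Suc n)) z)" for z
  have hol: "(\<lambda>z. exp (g z)) holomorphic_on ball 0 (1 + s N)"
    unfolding g_def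
  proof (intro holomorphic_intros)
    fix n assume "n \<in> {n0..<N}"
    then have "s N \<le> s (Suc n)" by (intro s_antimono) auto
    then show "herglotz (s (Suc n)) holomorphic_on ball 0 (1 + s N)"
      by (intro holomorphic_on_subset[OF holomorphic_herglotz] subset_ball) auto
  qed
  obtain p where p: "\<And>z. cmod z \<le> 1 \<Longrightarrow> cmod (poly p z - exp (g z)) < \<epsilon> / 2"
    using polynomial_approximation[OF hol, of "\<epsilon> / 2"] \<open>0 < \<epsilon>\<close> by auto
  have "weighted_abs \<Lambda> (\<lambda>z. poly p z * Sa a z - Sa (3 / 4 * a) z) z \<le> \<epsilon>" if z: "z \<in> unit_disc" for z
  proof -
    define y where "y = 1 - cmod z"
    have y: "0 < y" "y \<le> 1" using z by (auto simp: y_def)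
    have "weighted_abs \<Lambda> (\<lambda>z. poly p z * Sa a z - exp (g z) * Sa a z) z
        \<le> cmod (poly p z * Sa a z - exp (g z) * Sa a z)"
      using z by (rule weighted_abs_le)
    also have "\<dots> = cmod (poly p z - exp (g z)) * cmod (Sa a z)"
      by (simp flip: norm_mult left_diff_distrib)
    also have "\<dots> \<le> \<epsilon> / 2 * 1"
      using p[of z] z norm_Sa_le_one[of a z] assms(2) \<open>0 < \<epsilon>\<close> by (intro mult_mono) auto
    finally have 1: "weighted_abs \<Lambda> (\<lambda>z. poly p z * Sa a z - exp (g z) * Sa a z) z \<le> \<epsilon> / 2" by simp
    \<comment> \<open>Near the circle both functions are at most
      \<open>exp (\<Lambda> y / 2)\<close> and the weight wins; elsewhere the poles have nearly
      merged with 1.\<close>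
    have 2: "weighted_abs \<Lambda> (\<lambda>z. exp (g z) * Sa a z - Sa (3 / 4 * a) z) z \<le> \<epsilon> / 2"
    proof (cases "y < \<delta>")
      case True
      have "Re (g z) \<le> a * Re (herglotz 0 z) + \<Lambda> y / 2"
        unfolding g_def y_def
      proof (intro Re_sum_herglotz_le)
        show "\<theta> \<le> a / 8" "\<theta> \<le> 1 / 6" using \<theta>(2) by (simp_all add: \<theta>0_def)
        show "\<theta> * sum mass {n0..<N} \<le> a / 4" using \<theta>(3) by (simp add: M_def)
        show "s (Suc n) \<le> 1" if "n \<in> {n0..<N}" for n using n0(1)[of "Suc n"] that by simp
      qed (use z \<theta> in auto)
      then have "cmod (exp (g z) * Sa a z) \<le> exp (\<Lambda> y / 2)"
        by (simp add: norm_mult norm_Sa flip: exp_add)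
      moreover have "1 \<le> exp (\<Lambda> y / 2)" using pos[of y] y by simp
      then have "cmod (Sa (3 / 4 * a) z) \<le> exp (\<Lambda> y / 2)"
        using order_trans[OF norm_Sa_le_one[of "3 / 4 * a" z]] assms z by simp
      ultimately have "cmod (exp (g z) * Sa a z - Sa (3 / 4 * a) z) \<le> 2 * exp (\<Lambda> y / 2)"
        using norm_triangle_ineq4[of "exp (g z) * Sa a z" "Sa (3 / 4 * a) z"] by linarith
      then have "weighted_abs \<Lambda> (\<lambda>z. exp (g z) * Sa a z - Sa (3 / 4 * a) z) z
          \<le> 2 * exp (\<Lambda> y / 2) * exp (- \<Lambda> y)"
        unfolding weighted_abs_def y_def by (intro mult_right_mono) auto
      also have "\<dots> = 2 * exp (- (\<Lambda> y / 2))" by (simp add: mult.assoc flip: exp_add)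
      also have "\<dots> \<le> \<epsilon> / 2" using \<delta>(2)[of y] True y by simp
      finally show ?thesis .
    next
      case False
      have "g z - of_real (a / 4) * herglotz 0 z
          = (\<Sum>n=n0..<N. of_real (\<theta> * mass n) * (herglotz (s (Suc n)) z - herglotz 0 z))"
        unfolding \<theta>(3)[symmetric] g_def M_def
        by (simp add: sum_subtractf sum_distrib_left sum_distrib_right right_diff_distrib mult.assoc)
      also have "cmod \<dots> \<le> (\<Sum>n=n0..<N. \<theta> * mass n * (2 * s n0 / y\<^sup>2))"
      proof (rule sum_norm_le)
        fix n assume n: "n \<in> {n0..<N}"
        have "cmod (herglotz (s (Suc n)) z - herglotz 0 z) \<le> 2 * s (Suc n) / y\<^sup>2"
          unfolding y_def using z by (intro herglotz_diff_le) auto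
        also have "\<dots> \<le> 2 * s n0 / y\<^sup>2"
          using s_antimono[of n0 "Suc n"] n by (intro divide_right_mono) auto
        finally show "cmod (of_real (\<theta> * mass n) * (herglotz (s (Suc n)) z - herglotz 0 z))
            \<le> \<theta> * mass n * (2 * s n0 / y\<^sup>2)"
          unfolding norm_mult norm_of_real using \<theta>(1) by (intro mult_mono) auto
      qed
      also have "\<dots> = \<theta> * M * (2 * s n0 / y\<^sup>2)"
        unfolding M_def sum_distrib_left sum_distrib_right ..
      also have "\<dots> = a / 4 * (2 * s n0 / y\<^sup>2)" by (simp only: \<theta>(3))
      also have "\<dots> \<le> a / 4 * (2 * s n0 / \<delta>\<^sup>2)"
        using False \<delta>(1) y assms by (intro mult_left_mono divide_left_mono power_mono mult_pos_pos) auto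
      also have "\<dots> < \<eta>" using n0(2)[of n0] \<delta>(1) assms by (simp add: field_simps)
      finally have *: "cmod (exp (g z - of_real (a / 4) * herglotz 0 z) - 1) < \<epsilon> / 2" by (rule \<eta>(2))
      have "exp (g z) * Sa a z - Sa (3 / 4 * a) z
          = Sa (3 / 4 * a) z * (exp (g z - of_real (a / 4) * herglotz 0 z) - 1)"
        unfolding Sa_def right_diff_distrib by (simp flip: exp_add)
      then have "cmod (exp (g z) * Sa a z - Sa (3 / 4 * a) z)
          = cmod (Sa (3 / 4 * a) z) * cmod (exp (g z - of_real (a / 4) * herglotz 0 z) - 1)"
        by (simp only: norm_mult)
      also have "\<dots> \<le> 1 * (\<epsilon> / 2)"
        using * norm_Sa_le_one[of "3 / 4 * a" z] assms z by (intro mult_mono) auto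
      finally have "cmod (exp (g z) * Sa a z - Sa (3 / 4 * a) z) \<le> \<epsilon> / 2" by simp
      then show ?thesis
        using weighted_abs_le[OF z, of "\<lambda>z. exp (g z) * Sa a z - Sa (3 / 4 * a) z"] by simp
    qed
    show ?thesis
      using weighted_abs_diff_triangle[of \<Lambda> "\<lambda>z. poly p z * Sa a z" "Sa (3 / 4 * a)" z "\<lambda>z. exp (g z) * Sa a z"] 1 2
      by simp
  qed
  then show "\<exists>p. \<forall>z\<in>unit_disc. weighted_abs \<Lambda> (\<lambda>z. poly p z * Sa a z - Sa (3 / 4 * a) z) z \<le> \<epsilon>" by blast
qed

lemma approx_Sa_power:
  assumes "\<not> summable b"
  shows "approx \<Lambda> S (Sa ((3 / 4) ^ n))"
proof (induction n)
  case 0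
  show ?case unfolding S_eq_Sa
    by (intro approxI exI[of _ 1]) (simp add: weighted_abs_def)
next
  case (Suc n)
  then show ?case using approx_trans approx_Sa_step[OF assms, of "(3 / 4) ^ n"] by simp
qed

text \<open>As \<open>a\<close> tends to 0, \<open>Sa a\<close> tends to 1 in norm: uniformly away
  from the circle, and by the weight near it, where its modulus is at most 1.\<close>

lemma approx_S_one:
  assumes "\<not> summable b"
  shows "approx \<Lambda> S (\<lambda>_. 1)"
proof (rule approx_closed)
  fix \<epsilon> :: real assume "0 < \<epsilon>"
  obtain \<delta> where \<delta>: "0 < \<delta>" "\<And>y. 0 < y \<Longrightarrow> y < \<delta> \<Longrightarrow> exp (- (\<Lambda> y / 2)) \<le> \<epsilon> / 2"
    using exp_Lambda_small[OF assms, of "\<epsilon> / 2"] \<open>0 < \<epsilon>\<close> by auto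
  obtain \<eta> where \<eta>: "0 < \<eta>" "\<And>w :: complex. cmod w < \<eta> \<Longrightarrow> cmod (exp w - 1) < \<epsilon>"
    using exp_near_zero[of "\<epsilon>"] \<open>0 < \<epsilon>\<close> by auto
  have "(\<lambda>n. (3 / 4 :: real) ^ n) \<longlonglongrightarrow> 0" by (intro LIMSEQ_power_zero) simp
  then have "eventually (\<lambda>n. (3 / 4 :: real) ^ n < \<eta> * \<delta> / 2) sequentially"
    by (rule order_tendstoD) (use \<eta> \<delta> in auto)
  then obtain n where n: "(3 / 4 :: real) ^ n < \<eta> * \<delta> / 2"
    unfolding eventually_sequentially by auto
  define a :: real where "a = (3 / 4) ^ n"
  have a: "0 < a" "a < \<eta> * \<delta> / 2" using n by (simp_all add: a_def)
  have "weighted_abs \<Lambda> (\<lambda>z. Sa a z - 1) z \<le> \<epsilon>" if z: "z \<in> unit_disc" for z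
  proof -
    define y where "y = 1 - cmod z"
    have y: "0 < y" "y \<le> 1" using z by (auto simp: y_def)
    show ?thesis
    proof (cases "y < \<delta>")
      case True
      have "cmod (Sa a z - 1) \<le> 2"
        using norm_triangle_ineq4[of "Sa a z" 1] norm_Sa_le_one[of a z] a z by simp
      then have "weighted_abs \<Lambda> (\<lambda>z. Sa a z - 1) z \<le> 2 * exp (- \<Lambda> y)"
        unfolding weighted_abs_def y_def by (intro mult_right_mono) auto
      also have "\<dots> \<le> 2 * exp (- (\<Lambda> y / 2))" using pos[of y] y by simp
      also have "\<dots> \<le> \<epsilon>" using \<delta>(2)[of y] y True by simp
      finally show ?thesis .
    next
      case False
      have "cmod (herglotz 0 z) = cmod (1 + z) / cmod (1 - z)"
        by (simp add: herglotz_def norm_divide)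
      also have "\<dots> \<le> 2 / \<delta>"
      proof (rule frac_le)
        show "cmod (1 + z) \<le> 2" using norm_triangle_ineq[of 1 z] z by simp
        show "\<delta> \<le> cmod (1 - z)" using herglotz_dist_ge(2)[of 0 z] z False by (simp add: y_def)
      qed (use \<delta> in auto)
      finally have "a * cmod (herglotz 0 z) \<le> a * (2 / \<delta>)" using a by (intro mult_left_mono) auto
      also have "\<dots> < \<eta>" using a \<delta> by (simp add: field_simps)
      finally have "cmod (- (of_real a * herglotz 0 z)) < \<eta>" using a by (simp add: norm_mult)
      then have "cmod (Sa a z - 1) < \<epsilon>" unfolding Sa_def by (rule \<eta>(2))
      then show ?thesis using weighted_abs_le[OF z, of "\<lambda>z. Sa a z - 1"] by simp
    qed
  qed
  then show "\<exists>h. approx \<Lambda> S h \<and> (\<forall>z\<in>unit_disc. weighted_abs \<Lambda> (\<lambda>z. h z - 1) z \<le> \<epsilon>)"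
    using approx_Sa_power[OF assms, of n] unfolding a_def by blast
qed

lemma B_inf_0_bounded:
  assumes lim: "filterlim \<Lambda> at_top (at_right 0)"
    and hol: "f holomorphic_on unit_disc" and bd: "\<And>z. z \<in> unit_disc \<Longrightarrow> cmod (f z) \<le> 1"
  shows "f \<in> B_inf_0 \<Lambda>"
proof -
  have "bdd_above (weighted_abs \<Lambda> f ` unit_disc)"
    using weighted_abs_le[of _ f] bd by (intro bdd_aboveI2[of _ _ 1]) (meson order_trans)
  moreover have "\<exists>\<delta>>0. \<forall>z\<in>unit_disc. 1 - cmod z < \<delta> \<longrightarrow> weighted_abs \<Lambda> f z < \<epsilon>" if "0 < \<epsilon>" for \<epsilon>
  proof -
    have "eventually (\<lambda>y. ln (1 / \<epsilon>) < \<Lambda> y) (at_right 0)"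
      using lim unfolding filterlim_at_top_dense by blast
    then obtain \<delta> where \<delta>: "0 < \<delta>" "\<And>y. 0 < y \<Longrightarrow> y < \<delta> \<Longrightarrow> ln (1 / \<epsilon>) < \<Lambda> y"
      unfolding eventually_at_right_field by auto
    have "weighted_abs \<Lambda> f z < \<epsilon>" if z: "z \<in> unit_disc" "1 - cmod z < \<delta>" for z
    proof -
      have "- \<Lambda> (1 - cmod z) < ln \<epsilon>" using \<delta>(2)[of "1 - cmod z"] z \<open>0 < \<epsilon>\<close> by (simp add: ln_div)
      then have "exp (- \<Lambda> (1 - cmod z)) < \<epsilon>" using \<open>0 < \<epsilon>\<close> by (metis exp_less_mono exp_ln)
      moreover have "weighted_abs \<Lambda> f z \<le> 1 * exp (- \<Lambda> (1 - cmod z))"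
        unfolding weighted_abs_def using bd[OF z(1)] by (intro mult_right_mono) auto
      ultimately show ?thesis by simp
    qed
    with \<delta>(1) show ?thesis by blast
  qed
  ultimately show ?thesis
    using hol by (simp add: B_inf_0_def B_inf_def analytic_on_open weighted_abs_tendsto_0_iff)
qed

lemma holomorphic_S: "S holomorphic_on unit_disc"
  unfolding S_def by (intro holomorphic_intros) auto

lemma cyclic_if_not_summable:
  assumes "\<not> summable b"
  shows "cyclic_in (B_inf_0 \<Lambda>) (norm_B \<Lambda>) S"
  unfolding cyclic_in_iff_approx
proof (intro conjI ballI)
  show "S \<in> B_inf_0 \<Lambda>"
    using Lambda_at_top[OF assms] holomorphic_S norm_Sa_le_one[of 1] by (intro B_inf_0_bounded) (auto simp: S_eq_Sa)
  show "approx \<Lambda> S g" if "g \<in> B_inf_0 \<Lambda>" for g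
    using approx_trans[OF approx_S_one[OF assms] polynomials_dense[OF that]] .
qed

section \<open>A harmonic majorant when the masses are summable\<close>

text \<open>\<open>20 = 4 * 5\<close>: a factor 4 is lost in replacing \<open>s j + |1 - z|\<close>
  by twice the larger term, and 5 remains to dominate \<open>P + \<Lambda>\<close>. The last pole
  serves the cut-off at distance \<open>s (Suc N)\<close>.\<close>

definition majorant :: "nat \<Rightarrow> nat \<Rightarrow> complex \<Rightarrow> complex" where
  "majorant J N z = (\<Sum>j=J..Suc N. of_real (20 * b j) * herglotz (s j) z)"

lemma Re_majorant: "Re (majorant J N z) = (\<Sum>j=J..Suc N. 20 * b j * Re (herglotz (s j) z))"
  by (simp add: majorant_def flip: of_real_mult)

lemma majorant_term_nonneg: "z \<in> unit_disc \<Longrightarrow> 0 \<le> 20 * b j * Re (herglotz (s j) z)"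
  by (intro mult_nonneg_nonneg Re_herglotz_nonneg) auto

lemma majorant_term_ge:
  assumes "z \<in> unit_disc"
  shows "20 * dyadic j / (s j + cmod (1 - z))\<^sup>2 \<le> 20 * b j * Re (herglotz (s j) z)"
proof -
  have "20 * dyadic j / (s j + cmod (1 - z))\<^sup>2 = 20 * b j * (s j / (s j + cmod (1 - z))\<^sup>2)"
    using b_times_s[of j] by simp
  also have "\<dots> \<le> 20 * b j * Re (herglotz (s j) z)"
    using assms by (intro mult_left_mono Re_herglotz_ge) auto
  finally show ?thesis .
qed

lemma majorant_term_ge_lam:
  assumes "z \<in> unit_disc" "cmod (1 - z) \<le> s j"
  shows "5 * lam j \<le> 20 * b j * Re (herglotz (s j) z)"
proof -
  have "5 * lam j = 20 * dyadic j / (2 * s j)\<^sup>2"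
    by (simp add: power_mult_distrib s_power2)
  also have "\<dots> \<le> 20 * dyadic j / (s j + cmod (1 - z))\<^sup>2"
    using assms by (intro divide_left_mono power_mono mult_pos_pos zero_less_power add_pos_nonneg) auto
  also have "\<dots> \<le> 20 * b j * Re (herglotz (s j) z)" using assms(1) by (rule majorant_term_ge)
  finally show ?thesis .
qed

lemma majorant_term_ge_dyadic:
  assumes "z \<in> unit_disc" "s j \<le> cmod (1 - z)"
  shows "5 * dyadic j / (cmod (1 - z))\<^sup>2 \<le> 20 * b j * Re (herglotz (s j) z)"
proof -
  have "5 * dyadic j / (cmod (1 - z))\<^sup>2 = 20 * dyadic j / (2 * cmod (1 - z))\<^sup>2"
    by (simp add: power_mult_distrib)
  also have "\<dots> \<le> 20 * dyadic j / (s j + cmod (1 - z))\<^sup>2"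
    using assms by (intro divide_left_mono power_mono mult_pos_pos zero_less_power add_pos_nonneg) auto
  also have "\<dots> \<le> 20 * b j * Re (herglotz (s j) z)" using assms(1) by (rule majorant_term_ge)
  finally show ?thesis .
qed

lemma majorant_ge_term:
  assumes "z \<in> unit_disc" "A \<subseteq> {J..Suc N}"
  shows "(\<Sum>j\<in>A. 20 * b j * Re (herglotz (s j) z)) \<le> Re (majorant J N z)"
  unfolding Re_majorant using assms majorant_term_nonneg by (intro sum_mono2) auto

text \<open>\<open>above\<close> is the closed form of all step conditions and \<open>i\<close> is a
  step whose strict form fails, so \<open>z\<close> lies on the staircase. The terms
  \<open>i\<close> and \<open>Suc i\<close> pay, except on the outermost edge.\<close>

lemma Poisson_plus_Lambda_le_majorant:
  fixes J N i :: nat and z :: complex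
  defines "\<rho> \<equiv> cmod (1 - z)" and "y \<equiv> 1 - cmod z"
  assumes z: "z \<in> unit_disc" and "s (Suc N) < \<rho>"
    and above: "\<And>j. j \<in> {J..N} \<Longrightarrow> \<rho> \<le> s (Suc j) \<or> dyadic j \<le> y"
    and i: "i \<in> {J..N}" "s (Suc i) \<le> \<rho>" "y \<le> dyadic i"
  shows "Re (herglotz 0 z) + \<Lambda> y \<le> Re (majorant J N z) + 3 * lam J"
proof -
  have y: "0 < y" "y \<le> 1" using z by (auto simp: y_def)
  have \<rho>: "0 < \<rho>" using assms(4) s_pos[of "Suc N"] by linarith
  have P: "Re (herglotz 0 z) \<le> 2 * y / \<rho>\<^sup>2"
    unfolding y_def \<rho>_def using z by (intro Poisson_le) auto
  have Pi: "Re (herglotz 0 z) \<le> 2 * dyadic i / \<rho>\<^sup>2"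
    using P i(3) divide_right_mono[of "2 * y" "2 * dyadic i" "\<rho>\<^sup>2"] by simp
  show ?thesis
  proof (cases "s (Suc i) = \<rho>")
    \<comment> \<open>Edge at constant distance from 1: here \<open>P\<close> costs
      \<open>4 * lam (Suc i)\<close> and \<open>\<Lambda> y\<close> one more, together the 5 of term
      \<open>Suc i\<close>.\<close>
    case True
    then have "i < N" using assms(4) i(1) by (cases "i = N") auto
    then have "dyadic (Suc i) \<le> y"
      using above[of "Suc i"] i(1) s_strict_antimono[of "Suc i" "Suc (Suc i)"] True by auto
    then have "\<Lambda> y \<le> lam (Suc i)" unfolding lam_def using y by (intro Lambda_mono) auto
    moreover have "2 * dyadic i / \<rho>\<^sup>2 = 4 * lam (Suc i)"
      unfolding True[symmetric] s_power2 by (simp add: dyadic_Suc)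
    moreover have "5 * lam (Suc i) \<le> Re (majorant J N z)"
      using majorant_term_ge_lam[OF z, of "Suc i"] majorant_ge_term[OF z, of "{Suc i}" J N] True i(1)
      by (simp add: \<rho>_def)
    ultimately show ?thesis using Pi lam_nonneg[of J] by linarith
  next
    case False
    then have "s (Suc i) < \<rho>" using i(2) by simp
    then have yi: "y = dyadic i" using above[OF i(1)] i(3) by simp
    show ?thesis
    proof (cases "\<rho> \<le> s i")
      case True
      \<comment> \<open>Edge at height \<open>dyadic i\<close>: term \<open>i\<close> pays for
        \<open>\<Lambda> y\<close>, term \<open>Suc i\<close> for \<open>P\<close>.\<close>
      have "(\<Sum>j\<in>{i, Suc i}. 20 * b j * Re (herglotz (s j) z)) \<le> Re (majorant J N z)"
        using i(1) by (intro majorant_ge_term z) auto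
      then have "20 * b i * Re (herglotz (s i) z) + 20 * b (Suc i) * Re (herglotz (s (Suc i)) z)
          \<le> Re (majorant J N z)" by simp
      moreover have "5 * lam i \<le> 20 * b i * Re (herglotz (s i) z)"
        using True by (intro majorant_term_ge_lam z) (simp add: \<rho>_def)
      moreover have "5 * dyadic (Suc i) / \<rho>\<^sup>2 \<le> 20 * b (Suc i) * Re (herglotz (s (Suc i)) z)"
        unfolding \<rho>_def using i(2) by (intro majorant_term_ge_dyadic z) (simp add: \<rho>_def)
      moreover have "2 * dyadic i / \<rho>\<^sup>2 \<le> 5 * dyadic (Suc i) / \<rho>\<^sup>2"
        by (intro divide_right_mono) (auto simp: dyadic_Suc)
      moreover have "\<Lambda> y = lam i" by (simp add: yi lam_def)
      ultimately show ?thesis using Pi lam_nonneg[of i] lam_nonneg[of J] by linarith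
    next
      case False
      \<comment> \<open>Outermost edge: were there a preceding step, it would force height at least
        \<open>2 * dyadic i\<close>. Here \<open>P\<close> costs \<open>2 * lam J\<close> and
        \<open>\<Lambda> y\<close> costs \<open>lam J\<close>.\<close>
      have "i = J"
      proof (rule ccontr)
        assume "i \<noteq> J"
        then obtain k where k: "i = Suc k" "k \<in> {J..N}" using i(1) by (cases i) auto
        then have "dyadic k \<le> dyadic i" using above[OF k(2)] False yi by simp
        then show False using dyadic_pos[of k] by (simp add: k(1) dyadic_Suc)
      qed
      have "2 * dyadic J / \<rho>\<^sup>2 \<le> 2 * dyadic J / (s J)\<^sup>2"
        using False \<open>i = J\<close> \<rho> by (intro divide_left_mono power_mono mult_pos_pos zero_less_power) auto
      also have "\<dots> = 2 * lam J" by (simp add: s_power2)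
      finally have "2 * dyadic J / \<rho>\<^sup>2 \<le> 2 * lam J" .
      moreover have "\<Lambda> y = lam J" by (simp add: yi \<open>i = J\<close> lam_def)
      moreover have "0 \<le> Re (majorant J N z)" using majorant_ge_term[OF z, of "{}"] by simp
      ultimately show ?thesis using Pi \<open>i = J\<close> by simp
    qed
  qed
qed

section \<open>The maximum principle above the staircase\<close>

lemma holomorphic_majorant: "majorant J N holomorphic_on unit_disc"
  unfolding majorant_def
  by (intro holomorphic_intros holomorphic_on_subset[OF holomorphic_herglotz] subset_ball) auto

text \<open>Applied to \<open>p\<close> times \<open>exp\<close> of minus the majorant; the
  conditions on \<open>w\<close> place it above the staircase. The crude bound \<open>A\<close>
  enters only on the cut-off arc and drops out of the result.\<close>

lemma polynomial_le_majorant: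
  fixes p :: "complex poly"
  assumes p: "\<And>z. z \<in> unit_disc \<Longrightarrow> cmod (poly p z) \<le> 2 * exp (Re (herglotz 0 z) + \<Lambda> (1 - cmod z))"
    and A: "0 < A" "\<And>z. cmod z \<le> 1 \<Longrightarrow> cmod (poly p z) \<le> A"
    and N: "J \<le> N" "ln A \<le> 5 * lam (Suc N)"
    and w: "s (Suc N) < cmod (1 - w)"
      "\<And>j. j \<in> {J..N} \<Longrightarrow> s (Suc j) \<le> cmod (1 - w) \<Longrightarrow> dyadic j < 1 - cmod w"
  shows "cmod (poly p w) \<le> 2 * exp (3 * lam J + Re (majorant J N w))"
proof -
  \<comment> \<open>\<open>G\<close> is cut off at distance \<open>s (Suc N)\<close> from \<open>1\<close>, where \<open>V\<close> already exceeds \<open>ln A\<close>; so its closure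
      stays inside the open disc and no boundary behaviour at \<open>1\<close> is needed.\<close>
  define G where "G = {z. s (Suc N) < cmod (1 - z)} \<inter>
    (\<Inter>j\<in>{J..N}. {z. cmod (1 - z) < s (Suc j) \<or> dyadic j < 1 - cmod z})"
  define K where "K = {z. s (Suc N) \<le> cmod (1 - z)} \<inter> {z. dyadic N \<le> 1 - cmod z} \<inter>
    (\<Inter>j\<in>{J..N}. {z. cmod (1 - z) \<le> s (Suc j) \<or> dyadic j \<le> 1 - cmod z})"
  have "open G"
    unfolding G_def by (intro open_Int open_INT ballI open_Collect_disj open_Collect_less continuous_intros) auto
  have "closed K"
    unfolding K_def by (intro closed_Int closed_INT ballI closed_Collect_disj closed_Collect_le continuous_intros)
  \<comment> \<open>For \<open>j = N\<close> the first alternative contradicts the cut-off, so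
    \<open>1 - |z|\<close> exceeds \<open>dyadic N\<close> on \<open>G\<close>; this is what keeps
    \<open>K\<close> inside the disc.\<close>
  have "G \<subseteq> K" using N(1) by (force simp: G_def K_def)
  then have GK: "closure G \<subseteq> K" using \<open>closed K\<close> by (rule closure_minimal)
  have disc: "K \<subseteq> unit_disc"
  proof
    fix z assume "z \<in> K"
    then show "z \<in> unit_disc" using dyadic_pos[of N] by (auto simp: K_def simp del: dyadic_pos)
  qed
  have "cmod (poly p w * exp (- majorant J N w)) \<le> 2 * exp (3 * lam J)"
  proof (rule maximum_modulus_frontier[where S = G and f = "\<lambda>z. poly p z * exp (- majorant J N z)"])
    have hol: "(\<lambda>z. poly p z * exp (- majorant J N z)) holomorphic_on unit_disc"
      by (intro holomorphic_intros holomorphic_majorant)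
    show "(\<lambda>z. poly p z * exp (- majorant J N z)) holomorphic_on interior G"
      using GK disc closure_subset interior_subset by (intro holomorphic_on_subset[OF hol]) blast
    show "continuous_on (closure G) (\<lambda>z. poly p z * exp (- majorant J N z))"
      using GK disc by (intro holomorphic_on_imp_continuous_on holomorphic_on_subset[OF hol]) blast
    show "bounded G"
      using GK disc closure_subset by (intro bounded_subset[OF bounded_ball]) blast
    show "w \<in> G" using w by (force simp: G_def)
    fix z assume "z \<in> frontier G"
    then have zK: "z \<in> K" and zG: "z \<notin> G"
      using GK interior_open[OF \<open>open G\<close>] by (auto simp: frontier_def)
    have z: "z \<in> unit_disc" using zK disc by blast
    have "cmod (poly p z) \<le> 2 * exp (3 * lam J) * exp (Re (majorant J N z))"
    proof (cases "cmod (1 - z) = s (Suc N)")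
      case True
      have "cmod (poly p z) \<le> exp (ln A)" using A z by simp
      also have "\<dots> \<le> exp (5 * lam (Suc N))" using N(2) by simp
      also have "\<dots> \<le> exp (Re (majorant J N z))"
        using majorant_term_ge_lam[OF z, of "Suc N"] majorant_ge_term[OF z, of "{Suc N}" J N] True N(1) by simp
      also have "\<dots> \<le> 2 * exp (3 * lam J) * exp (Re (majorant J N z))"
      proof -
        have "1 \<le> exp (3 * lam J)" by simp
        then have "1 \<le> 2 * exp (3 * lam J)" by linarith
        then show ?thesis by simp
      qed
      finally show ?thesis .
    next
      case False
      then have 1: "s (Suc N) < cmod (1 - z)" using zK by (auto simp: K_def)
      with zG obtain i where i: "i \<in> {J..N}" "s (Suc i) \<le> cmod (1 - z)" "1 - cmod z \<le> dyadic i"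
        by (auto simp: G_def not_less)
      have "Re (herglotz 0 z) + \<Lambda> (1 - cmod z) \<le> Re (majorant J N z) + 3 * lam J"
        using zK by (intro Poisson_plus_Lambda_le_majorant[OF z 1 _ i]) (auto simp: K_def)
      then have "2 * exp (Re (herglotz 0 z) + \<Lambda> (1 - cmod z)) \<le> 2 * exp (Re (majorant J N z) + 3 * lam J)"
        by simp
      then show ?thesis using p[OF z] by (simp add: exp_add mult.commute)
    qed
    then show "cmod (poly p z * exp (- majorant J N z)) \<le> 2 * exp (3 * lam J)"
      unfolding norm_mult norm_exp_eq_Re by (simp add: exp_minus divide_simps mult.commute)
  qed
  then show ?thesis
    unfolding norm_mult norm_exp_eq_Re by (simp add: exp_minus exp_add divide_simps mult_ac)
qed

section \<open>Failure of approximation when the masses are summable\<close>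

lemma Lambda_at_top_if_S_in:
  assumes "S \<in> B_inf_0 \<Lambda>"
  shows "filterlim \<Lambda> at_top (at_right 0)"
  unfolding filterlim_at_top eventually_at_right_field
proof
  fix Z :: real
  have "\<exists>\<delta>>0. \<forall>z\<in>unit_disc. 1 - cmod z < \<delta> \<longrightarrow> weighted_abs \<Lambda> S z < exp (- 1 - Z)"
    using assms unfolding B_inf_0_def weighted_abs_tendsto_0_iff by simp
  then obtain \<delta> where \<delta>: "0 < \<delta>"
    "\<And>z. z \<in> unit_disc \<Longrightarrow> 1 - cmod z < \<delta> \<Longrightarrow> weighted_abs \<Lambda> S z < exp (- 1 - Z)" by blast
  have "Z \<le> \<Lambda> y" if y: "0 < y" "y < min 1 \<delta>" for y
  proof -
    \<comment> \<open>On the negative radius \<open>|S|\<close> is at least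
      \<open>exp (- 1)\<close>, so only the weight can make \<open>weighted_abs\<close>
      small.\<close>
    define x where "x = 1 - y"
    have x: "0 < x" "x < 1" using y by (auto simp: x_def)
    have nx: "cmod (- of_real x) = 1 - y"
      unfolding norm_minus_cancel norm_of_real using x by (simp add: x_def)
    have "herglotz 0 (- of_real x) = of_real ((1 - x) / (1 + x))" by (simp add: herglotz_def)
    then have "cmod (S (- of_real x)) = exp (- ((1 - x) / (1 + x)))" by (simp add: S_eq_Sa norm_Sa)
    moreover have "(1 - x) / (1 + x) \<le> 1" using x by simp
    ultimately have "exp (- 1) \<le> cmod (S (- of_real x))" by simp
    then have "exp (- 1) * exp (- \<Lambda> y) \<le> weighted_abs \<Lambda> S (- of_real x)"
      unfolding weighted_abs_def nx by simp
    also have "\<dots> < exp (- 1 - Z)" using \<delta>(2)[of "- of_real x"] y nx by simp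
    finally show ?thesis by (simp flip: exp_add)
  qed
  then show "\<exists>b>0. \<forall>y>0. y < b \<longrightarrow> Z \<le> \<Lambda> y" using \<delta>(1) by (intro exI[of _ "min 1 \<delta>"]) auto
qed

text \<open>On the radius towards 1, \<open>|1 - w|\<close> and \<open>1 - |w|\<close> agree, so
  small \<open>b\<close> puts the radius above the staircase.\<close>

lemma dyadic_less_s_Suc:
  assumes "b (Suc j) < 1 / 2"
  shows "dyadic j < s (Suc j)"
proof -
  have "dyadic j = 2 * (b (Suc j) * s (Suc j))" unfolding b_times_s by (simp add: dyadic_Suc)
  also have "\<dots> < 1 * s (Suc j)" using assms by (simp add: mult.assoc[symmetric])
  finally show ?thesis by simp
qed

lemma not_approx_one:
  assumes lim: "filterlim \<Lambda> at_top (at_right 0)" and sum: "summable b"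
  shows "\<not> approx \<Lambda> S (\<lambda>_. 1)"
proof
  assume approx: "approx \<Lambda> S (\<lambda>_. 1)"
  \<comment> \<open>On the radius the majorant is at most \<open>60 / y\<close> times the tail sum,
    where \<open>60 = 20 * 3\<close>; this leaves \<open>1 / (2 * y)\<close>.\<close>
  obtain J where J: "\<And>m n. J \<le> m \<Longrightarrow> norm (\<Sum>k=m..n. b k) < 1 / 120"
    using summable_partial_sum_bound[OF sum, of "1 / 120"] by auto
  have bJ: "b j < 1 / 2" if "J \<le> j" for j using J[OF that, of j] by simp
  \<comment> \<open>\<open>ln 4\<close> collects the factors 2 of \<open>upper\<close> and
    \<open>lower\<close>. \<open>C\<close> and \<open>y\<close> are fixed before \<open>p\<close>,
    with \<open>y\<close> so small that \<open>2 - y \<le> y * C + 1 / 2\<close> fails.\<close>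
  define C where "C = ln 4 + 3 * lam J"
  have C: "0 < C" unfolding C_def by (intro add_pos_pos) auto
  define y where "y = min (1 / 4) (1 / (4 * C))"
  have y: "0 < y" "y \<le> 1 / 4" "y * C \<le> 1 / 4" using C by (auto simp: y_def min_def field_simps)
  define w :: complex where "w = of_real (1 - y)"
  have norm_w: "cmod w = 1 - y" unfolding w_def norm_of_real using y by simp
  then have w: "cmod w = 1 - y" "1 - w = of_real y" "w \<in> unit_disc" using y by (auto simp: w_def)
  \<comment> \<open>Half the weight at \<open>w\<close> forces \<open>|p S - 1| \<le> 1/2\<close>
    there.\<close>
  define \<epsilon> where "\<epsilon> = exp (- \<Lambda> y) / 2"
  have "0 < \<epsilon>" by (simp add: \<epsilon>_def)
  have \<epsilon>1: "\<epsilon> \<le> 1" using pos[of y] y by (simp add: \<epsilon>_def) (smt (verit) exp_le_one_iff)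
  obtain p where p: "\<And>z. z \<in> unit_disc \<Longrightarrow> weighted_abs \<Lambda> (\<lambda>z. poly p z * S z - 1) z \<le> \<epsilon>"
    using approxD[OF approx \<open>0 < \<epsilon>\<close>] by blast
  have norm_S: "cmod (S z) = exp (- Re (herglotz 0 z))" for z by (simp add: S_eq_Sa norm_Sa)
  have upper: "cmod (poly p z) \<le> 2 * exp (Re (herglotz 0 z) + \<Lambda> (1 - cmod z))" if z: "z \<in> unit_disc" for z
  proof -
    have "cmod (poly p z * S z - 1) * exp (- \<Lambda> (1 - cmod z)) \<le> 1"
      using p[OF z] \<epsilon>1 by (simp add: weighted_abs_def)
    then have "cmod (poly p z * S z - 1) \<le> exp (\<Lambda> (1 - cmod z))" by (simp add: exp_minus field_simps)
    moreover have "1 \<le> exp (\<Lambda> (1 - cmod z))" using pos[of "1 - cmod z"] z by simp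
    ultimately have "cmod (poly p z * S z) \<le> 2 * exp (\<Lambda> (1 - cmod z))"
      using norm_triangle_ineq[of "poly p z * S z - 1" 1] by (simp del: one_le_exp_iff)
    then show ?thesis by (simp add: norm_mult norm_S exp_add exp_minus field_simps)
  qed
  have lower: "exp ((2 - y) / y) \<le> 2 * cmod (poly p w)"
  proof -
    have "cmod (poly p w * S w - 1) * exp (- \<Lambda> y) \<le> exp (- \<Lambda> y) / 2"
      using p[OF w(3)] by (simp add: weighted_abs_def w(1) \<epsilon>_def)
    then have "cmod (poly p w * S w - 1) \<le> 1 / 2" by (simp add: field_simps)
    then have "1 / 2 \<le> cmod (poly p w * S w)"
      using norm_triangle_ineq2[of 1 "1 - poly p w * S w"] by (simp add: norm_minus_commute)
    moreover have "herglotz 0 w = of_real ((2 - y) / y)"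
      using y by (simp add: herglotz_def w_def)
    then have "Re (herglotz 0 w) = (2 - y) / y" by simp
    ultimately show ?thesis by (simp add: norm_mult norm_S exp_minus field_simps)
  qed
  obtain A where A: "0 < A" "\<And>z. cmod z \<le> 1 \<Longrightarrow> cmod (poly p z) \<le> A"
    using poly_bounded_on_disc by blast
  have "filterlim dyadic (at_right 0) sequentially"
    using dyadic_tendsto_0 by (simp add: filterlim_at)
  then have "filterlim lam at_top sequentially"
    unfolding lam_def using filterlim_compose[OF lim] by blast
  then have "eventually (\<lambda>n. ln A / 5 \<le> lam n) sequentially"
    unfolding filterlim_at_top by blast
  moreover have "eventually (\<lambda>n. s n < y) sequentially"
    using s_tendsto_0 y(1) by (rule order_tendstoD)
  ultimately have "eventually (\<lambda>n. ln A / 5 \<le> lam n \<and> s n < y) sequentially" by (rule eventually_conj)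
  then obtain N0 where N0: "\<And>n. N0 \<le> n \<Longrightarrow> ln A / 5 \<le> lam n \<and> s n < y"
    unfolding eventually_sequentially by blast
  \<comment> \<open>\<open>N\<close> may depend on \<open>p\<close> through \<open>A\<close>, since
    the final bound contains neither.\<close>
  define N where "N = max J N0"
  have N: "J \<le> N" "ln A \<le> 5 * lam (Suc N)" "s (Suc N) < y"
    using N0[of "Suc N"] max.cobounded2[of N0 J] by (auto simp: N_def max.commute)
  have "cmod (poly p w) \<le> 2 * exp (3 * lam J + Re (majorant J N w))"
  proof (rule polynomial_le_majorant[OF upper A N(1,2)])
    show "s (Suc N) < cmod (1 - w)" using N(3) y by (simp add: w(2))
    show "dyadic j < 1 - cmod w" if "j \<in> {J..N}" "s (Suc j) \<le> cmod (1 - w)" for j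
      using dyadic_less_s_Suc[OF bJ, of j] that y by (simp add: w(1,2))
  qed
  also have "Re (majorant J N w) \<le> 1 / (2 * y)"
  proof -
    have "Re (majorant J N w) \<le> (\<Sum>j=J..Suc N. 20 * b j * (3 / y))"
      unfolding Re_majorant
    proof (intro sum_mono mult_left_mono)
      fix j
      have "Re (herglotz (s j) w) \<le> cmod (herglotz (s j) w)" by (rule complex_Re_le_cmod)
      also have "\<dots> \<le> 3 / (1 - cmod w)" using w(3) by (intro norm_herglotz_le) auto
      finally show "Re (herglotz (s j) w) \<le> 3 / y" by (simp add: w(1))
    qed simp
    also have "\<dots> = 60 / y * (\<Sum>j=J..Suc N. b j)"
      unfolding sum_distrib_left by (intro sum.cong) simp_all
    also have "\<dots> \<le> 60 / y * (1 / 120)"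
      using J[of J "Suc N"] y by (intro mult_left_mono) auto
    finally show ?thesis by simp
  qed
  finally have "exp ((2 - y) / y) \<le> 4 * exp (3 * lam J + 1 / (2 * y))"
    using lower by simp
  also have "\<dots> = exp (C + 1 / (2 * y))" by (simp add: C_def exp_add)
  finally have "(2 - y) / y \<le> C + 1 / (2 * y)" by simp
  then have "y * ((2 - y) / y) \<le> y * (C + 1 / (2 * y))" using y by (intro mult_left_mono) auto
  then have "2 - y \<le> y * C + 1 / 2" using y by (simp add: distrib_left)
  then show False using y by linarith
qed

text \<open>Cyclicity includes membership of \<open>S\<close>, which forces \<open>\<Lambda>\<close>
  to infinity; hence the constant 1 lies in the space and would have to be approximated.\<close>

lemma cyclic_iff_not_summable:
  "cyclic_in (B_inf_0 \<Lambda>) (norm_B \<Lambda>) S \<longleftrightarrow> \<not> summable b"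
proof
  assume cyc: "cyclic_in (B_inf_0 \<Lambda>) (norm_B \<Lambda>) S"
  then have lim: "filterlim \<Lambda> at_top (at_right 0)"
    unfolding cyclic_in_iff_approx by (intro Lambda_at_top_if_S_in) blast
  have "(\<lambda>_. 1) \<in> B_inf_0 \<Lambda>" using lim by (intro B_inf_0_bounded) auto
  then have "approx \<Lambda> S (\<lambda>_. 1)" using cyc unfolding cyclic_in_iff_approx by blast
  then show "\<not> summable b" using not_approx_one[OF lim] by blast
qed (rule cyclic_if_not_summable)

section \<open>Dyadic form of the integral condition\<close>

lemma nn_integral_dyadic_steps:
  fixes c :: "nat \<Rightarrow> real"
  assumes "\<And>n. 0 \<le> c n"
  shows "(\<integral>\<^sup>+ x. (\<Sum>n. ennreal (c n) * indicator {dyadic (Suc n)<..dyadic n} x) \<partial>lborel)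
    = (\<Sum>n. ennreal (c n * dyadic (Suc n)))"
proof -
  have "(\<integral>\<^sup>+ x. (\<Sum>n. ennreal (c n) * indicator {dyadic (Suc n)<..dyadic n} x) \<partial>lborel)
      = (\<Sum>n. \<integral>\<^sup>+ x. ennreal (c n) * indicator {dyadic (Suc n)<..dyadic n} x \<partial>lborel)"
    by (intro nn_integral_suminf) auto
  moreover have "emeasure lborel {dyadic (Suc n)<..dyadic n} = ennreal (dyadic (Suc n))" for n
    by (simp add: dyadic_Suc)
  then have "(\<Sum>n. \<integral>\<^sup>+ x. ennreal (c n) * indicator {dyadic (Suc n)<..dyadic n} x \<partial>lborel)
      = (\<Sum>n. ennreal (c n * dyadic (Suc n)))"
    using assms by (simp add: nn_integral_cmult_indicator ennreal_mult)
  ultimately show ?thesis by simp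
qed

lemma sqrt_lam_div_dyadic: "sqrt (lam n / dyadic n) * dyadic n = b n"
proof -
  have "sqrt (lam n / dyadic n) * dyadic n = sqrt (lam n / dyadic n) * sqrt ((dyadic n)\<^sup>2)" by simp
  also have "\<dots> = b n" unfolding b_def real_sqrt_mult[symmetric] by (simp add: power2_eq_square mult.commute)
  finally show ?thesis .
qed

text \<open>On each dyadic interval the integrand lies between its endpoint values; the two step
  functions integrate to the series of \<open>b n / 2\<close> and of
  \<open>b (Suc n)\<close>.\<close>

lemma integral_infinite_iff_not_summable:
  "(\<integral>\<^sup>+ t\<in>{0<..1}. ennreal (sqrt (\<Lambda> t / t)) \<partial>lborel) = \<infinity> \<longleftrightarrow> \<not> summable b"
proof -
  define I where "I = (\<integral>\<^sup>+ t\<in>{0<..1}. ennreal (sqrt (\<Lambda> t / t)) \<partial>lborel)"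
  have cover: "\<exists>n. x \<in> {dyadic (Suc n)<..dyadic n}" if "x \<in> {0<..1}" for x
  proof -
    have ex: "\<exists>n. dyadic n < x"
      using order_tendstoD(2)[OF dyadic_tendsto_0, of x] that by (auto simp: eventually_sequentially)
    \<comment> \<open>The first scale below \<open>x\<close> is not the scale 1, as
      \<open>x \<le> 1\<close>; its predecessor is the right end of the half-open interval.\<close>
    define m where "m = (LEAST n. dyadic n < x)"
    have m: "dyadic m < x" unfolding m_def using ex by (rule LeastI_ex)
    then have "m \<noteq> 0" using that by (auto simp: dyadic_def intro!: gr0I)
    then obtain n where n: "m = Suc n" by (cases m) auto
    then have "\<not> dyadic n < x" using not_less_Least[of n "\<lambda>n. dyadic n < x"] by (simp add: m_def)
    then show ?thesis using m n by auto
  qed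
  have disj: "disjoint_family (\<lambda>n. {dyadic (Suc n)<..dyadic n})"
  proof -
    have "{dyadic (Suc m)<..dyadic m} \<inter> {dyadic (Suc n)<..dyadic n} = {}" if "m < n" for m n
      using dyadic_antimono[of "Suc m" n] that by auto
    then show ?thesis unfolding disjoint_family_on_def by (metis Int_commute linorder_neqE_nat)
  qed
  have step: "(\<Sum>n. ennreal (c n) * indicator {dyadic (Suc n)<..dyadic n} x) = ennreal (c k)"
    if "x \<in> {dyadic (Suc k)<..dyadic k}" for c :: "nat \<Rightarrow> real" and x k
    using suminf_cmult_indicator[OF disj that, of "\<lambda>n. ennreal (c n)"] by simp
  have val: "\<Lambda> x \<le> lam (Suc k)" "lam k \<le> \<Lambda> x" "0 < x" "x \<le> 1"
    if "x \<in> {dyadic (Suc k)<..dyadic k}" for x k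
    using that dyadic_pos[of "Suc k"] dyadic_le_one[of k] unfolding lam_def
    by (auto intro!: Lambda_mono simp del: dyadic_pos dyadic_le_one)
  have "I \<le> (\<integral>\<^sup>+ x. (\<Sum>n. ennreal (sqrt (lam (Suc n) / dyadic (Suc n)))
      * indicator {dyadic (Suc n)<..dyadic n} x) \<partial>lborel)"
    unfolding I_def
  proof (rule nn_integral_mono)
    fix x :: real
    show "ennreal (sqrt (\<Lambda> x / x)) * indicator {0<..1} x
      \<le> (\<Sum>n. ennreal (sqrt (lam (Suc n) / dyadic (Suc n))) * indicator {dyadic (Suc n)<..dyadic n} x)"
    proof (cases "x \<in> {0<..1}")
      case True
      then obtain k where k: "x \<in> {dyadic (Suc k)<..dyadic k}" using cover by blast
      have "\<Lambda> x / x \<le> lam (Suc k) / dyadic (Suc k)" using val[OF k] k by (intro frac_le) auto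
      then show ?thesis using True unfolding step[OF k] by (simp add: ennreal_leI)
    qed simp
  qed
  also have "\<dots> = (\<Sum>n. ennreal (b (Suc n)))"
    by (subst nn_integral_dyadic_steps) (simp_all only: sqrt_lam_div_dyadic, simp)
  finally have upper: "I \<le> (\<Sum>n. ennreal (b (Suc n)))" .
  have "(\<Sum>n. ennreal (b n / 2)) = (\<integral>\<^sup>+ x. (\<Sum>n. ennreal (sqrt (lam n / dyadic n))
      * indicator {dyadic (Suc n)<..dyadic n} x) \<partial>lborel)"
    by (subst nn_integral_dyadic_steps) (simp_all add: dyadic_Suc sqrt_lam_div_dyadic)
  also have "\<dots> \<le> I"
    unfolding I_def
  proof (rule nn_integral_mono)
    fix x :: real
    show "(\<Sum>n. ennreal (sqrt (lam n / dyadic n)) * indicator {dyadic (Suc n)<..dyadic n} x)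
      \<le> ennreal (sqrt (\<Lambda> x / x)) * indicator {0<..1} x"
    proof (cases "\<exists>k. x \<in> {dyadic (Suc k)<..dyadic k}")
      case True
      then obtain k where k: "x \<in> {dyadic (Suc k)<..dyadic k}" by blast
      have "lam k / dyadic k \<le> \<Lambda> x / x" using val[OF k] k pos[of x] by (intro frac_le) auto
      then show ?thesis using val[OF k] unfolding step[OF k] by (simp add: ennreal_leI)
    next
      case False
      then have "\<And>n. indicator {dyadic (Suc n)<..dyadic n} x = (0 :: ennreal)"
        by (auto simp: indicator_def)
      then show ?thesis by simp
    qed
  qed
  finally have lower: "(\<Sum>n. ennreal (b n / 2)) \<le> I" .
  show ?thesis
    unfolding I_def[symmetric]
  proof
    assume "I = \<infinity>"
    then have top: "(\<Sum>n. ennreal (b (Suc n))) = \<infinity>" using upper by (simp add: top_unique)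
    show "\<not> summable b"
    proof
      assume "summable b"
      then have "summable (\<lambda>n. b (Suc n))" by (simp add: summable_Suc_iff)
      then show False using top by (simp add: suminf_ennreal2)
    qed
  next
    assume ns: "\<not> summable b"
    show "I = \<infinity>"
    proof (rule ccontr)
      assume "I \<noteq> \<infinity>"
      then have "(\<Sum>n. ennreal (b n / 2)) \<noteq> top" using lower by (auto simp: top_unique)
      then have "summable (\<lambda>n. b n / 2)" by (intro summable_suminf_not_top) auto
      then show False using ns summable_mult[of "\<lambda>n. b n / 2" 2] by simp
    qed
  qed
qed

end

theorem theorem1:
  fixes \<Lambda> :: "real \<Rightarrow> real"
  assumes "\<And>t. t \<in> {0<..1} \<Longrightarrow> \<Lambda> t > 0"
    and "antimono_on {0<..1} \<Lambda>"
    and "continuous_on {0<..1} \<Lambda>"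
  shows "cyclic_in (B_inf_0 \<Lambda>) (norm_B \<Lambda>) S \<longleftrightarrow>
    (\<integral>\<^sup>+ t\<in>{0<..1}. ennreal (sqrt (\<Lambda> t / t)) \<partial>lborel) = \<infinity>"
proof -
  interpret weight \<Lambda> using assms by unfold_locales auto
  show ?thesis
    unfolding cyclic_iff_not_summable integral_infinite_iff_not_summable ..
qed

end
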